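(* Let $\mathscr A$ be a $C^*$-algebra, let $\mathscr E$ be a Hilbert $C^*$-module over $\mathscr A$, and let $\mathscr H$ and $\mathscr K$ be closed submodules of $\mathscr E$ such that $(\mathscr H^\perp,\mathscr K^\perp)$ is concordant. If $\alpha_0(\mathscr H^{\perp\perp},\mathscr K^{\perp\perp})<1$, then $(\mathscr H^{\perp\perp},\mathscr K^{\perp\perp})$ is a separated pair.
   Context: For a submodule $\mathscr M\subseteq\mathscr E$, $\mathscr M^\perp=\{x\in\mathscr E:\langle x,y\rangle=0\text{ for all }y\in\mathscr M\}$ and $\mathscr M^{\perp\perp}=(\mathscr M^\perp)^\perp$; $\mathscr M$ is orthogonally complemented in $\mathscr E$ if $\mathscr M\oplus\mathscr M^\perp=\mathscr E$. A pair $(\mathscr M,\mathscr N)$ of closed submodules of $\mathscr E$ is a separated pair if $\mathscr M\cap\mathscr N=0$ and $\mathscr M+\mathscr N$ is orthogonally complemented in $\mathscr E$. A pair $(\mathscr M,\mathscr N)$ of closed submodules of $\mathscr E$ is concordant if $\mathscr E$ decomposes orthogonally as $\mathscr E=(\mathscr M\cap\mathscr N)\oplus\overline{\mathscr M^\perp+\mathscr N^\perp}$. Localization: for a positive linear functional $f$ on $\mathscr A$, let $\mathscr N_f=\{x\in\mathscr E: f(\langle x,x\rangle)=0\}$, a closed subspace of $\mathscr E$. The quotient $\mathscr E/\mathscr N_f$ is a pre-Hilbert space with inner product $\langle x+\mathscr N_f,y+\mathscr N_f\rangle_f=f(\langle x,y\rangle)$; $\mathscr E_f$ is its Hilbert space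 completion. For a closed submodule $\mathscr H$ of $\mathscr E$, $\mathscr H_f$ is the closure of $\{x+\mathscr N_f:x\in\mathscr H\}$ in $\mathscr E_f$. Angles: for closed subspaces $M,N$ of a Hilbert space, the cosine of the Dixmier angle is $c_0(M,N)=\sup\{|\langle x,y\rangle|: x\in M,\ y\in N,\ \|x\|\le1,\ \|y\|\le1\}$. The cosine of the local Dixmier angle between closed submodules $\mathscr H,\mathscr K$ of $\mathscr E$ is $\alpha_0(\mathscr H,\mathscr K)=\sup_f c_0(\mathscr H_f,\mathscr K_f)$, the supremum over all states $f$ on $\mathscr A$. *)

theory Defs
  imports "HOL-Analysis.Analysis" "HOL-Library.Set_Algebras"
begin

section \<open>C*-algebras\<close>

class scaleC =
  fixes scaleC :: "complex \<Rightarrow> 'a \<Rightarrow> 'a"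

class complex_banach = scaleC + banach +
  assumes scaleC_add_right: "scaleC c (x + y) = scaleC c x + scaleC c y"
    and scaleC_add_left: "scaleC (c + d) x = scaleC c x + scaleC d x"
    and scaleC_scaleC: "scaleC c (scaleC d x) = scaleC (c * d) x"
    and scaleC_of_real: "scaleC (complex_of_real r) x = scaleR r x"
    and norm_scaleC: "norm (scaleC c x) = cmod c * norm x"

text \<open>No unit is assumed, and the zero algebra is allowed.\<close>

class cstar_algebra = complex_banach + real_normed_algebra +
  fixes adj :: "'a \<Rightarrow> 'a"
  assumes scaleC_mult_left: "scaleC c x * y = scaleC c (x * y)"
    and scaleC_mult_right: "x * scaleC c y = scaleC c (x * y)"
    and adj_add: "adj (x + y) = adj x + adj y"
    and adj_scaleC: "adj (scaleC c x) = scaleC (cnj c) (adj x)"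
    and adj_mult: "adj (x * y) = adj y * adj x"
    and adj_adj: "adj (adj x) = x"
    and cstar_identity: "norm (adj x * x) = (norm x)\<^sup>2"

definition positive :: "'a::cstar_algebra \<Rightarrow> bool" where
  "positive a \<longleftrightarrow> (\<exists>b. a = adj b * b)"

definition positive_functional :: "('a::cstar_algebra \<Rightarrow> complex) \<Rightarrow> bool" where
  "positive_functional f \<longleftrightarrow>
     (\<forall>a b. f (a + b) = f a + f b) \<and> (\<forall>c a. f (scaleC c a) = c * f a) \<and>
     (\<forall>a. positive a \<longrightarrow> Im (f a) = 0 \<and> 0 \<le> Re (f a))"

text \<open>Positive functionals are automatically bounded; boundedness is stated because
  \<^const>\<open>onorm\<close> is meaningful only for bounded maps.\<close>

definition state :: "('a::cstar_algebra \<Rightarrow> complex) \<Rightarrow> bool" where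
  "state f \<longleftrightarrow> positive_functional f \<and> bounded_linear f \<and> onorm f = 1"


section \<open>Hilbert C*-modules\<close>

text \<open>A right Hilbert module over the algebra \<^typ>\<open>'a\<close>, with inner product linear in the second
  variable. The norm of \<^typ>\<open>'e\<close> is the one given by the inner product, so completeness of the
  module is the completeness of \<^typ>\<open>'e\<close> as a Banach space.\<close>

locale hilbert_module =
  fixes act :: "'e::complex_banach \<Rightarrow> 'a::cstar_algebra \<Rightarrow> 'e"
    and ip :: "'e \<Rightarrow> 'e \<Rightarrow> 'a"
  assumes act_add_left: "act (x + y) a = act x a + act y a"
    and act_add_right: "act x (a + b) = act x a + act x b"
    and act_mult: "act x (a * b) = act (act x a) b"
    and act_scaleC_left: "act (scaleC c x) a = scaleC c (act x a)"
    and act_scaleC_right: "act x (scaleC c a) = scaleC c (act x a)"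
    and ip_add_right: "ip x (y + z) = ip x y + ip x z"
    and ip_scaleC_right: "ip x (scaleC c y) = scaleC c (ip x y)"
    and ip_act_right: "ip x (act y a) = ip x y * a"
    and ip_adj: "ip y x = adj (ip x y)"
    and ip_positive: "positive (ip x x)"
    and ip_definite: "ip x x = 0 \<Longrightarrow> x = 0"
    and norm_ip: "norm x = sqrt (norm (ip x x))"

definition closed_submodule ::
    "('e::complex_banach \<Rightarrow> 'a::cstar_algebra \<Rightarrow> 'e) \<Rightarrow> 'e set \<Rightarrow> bool" where
  "closed_submodule act M \<longleftrightarrow>
     0 \<in> M \<and> (\<forall>x\<in>M. \<forall>y\<in>M. x + y \<in> M) \<and> (\<forall>c. \<forall>x\<in>M. scaleC c x \<in> M) \<and>
     (\<forall>a. \<forall>x\<in>M. act x a \<in> M) \<and> closed M"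

definition orth :: "('e \<Rightarrow> 'e \<Rightarrow> 'a::cstar_algebra) \<Rightarrow> 'e set \<Rightarrow> 'e set" where
  "orth ip M = {x. \<forall>y\<in>M. ip x y = 0}"

text \<open>The whole module is the orthogonal direct sum of \<open>M\<close> and \<open>N\<close>; for submodules, orthogonality
  forces \<open>M \<inter> N = {0}\<close>.\<close>

definition orth_direct_sum ::
    "('e::complex_banach \<Rightarrow> 'e \<Rightarrow> 'a::cstar_algebra) \<Rightarrow> 'e set \<Rightarrow> 'e set \<Rightarrow> bool" where
  "orth_direct_sum ip M N \<longleftrightarrow> (\<forall>x\<in>M. \<forall>y\<in>N. ip x y = 0) \<and> M + N = UNIV"

definition orth_complemented ::
    "('e::complex_banach \<Rightarrow> 'e \<Rightarrow> 'a::cstar_algebra) \<Rightarrow> 'e set \<Rightarrow> bool" where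
  "orth_complemented ip M \<longleftrightarrow> orth_direct_sum ip M (orth ip M)"

definition separated_pair ::
    "('e::complex_banach \<Rightarrow> 'a::cstar_algebra \<Rightarrow> 'e) \<Rightarrow> ('e \<Rightarrow> 'e \<Rightarrow> 'a) \<Rightarrow> 'e set \<Rightarrow> 'e set \<Rightarrow> bool"
  where
  "separated_pair act ip M N \<longleftrightarrow>
     closed_submodule act M \<and> closed_submodule act N \<and>
     M \<inter> N = {0} \<and> orth_complemented ip (M + N)"

definition concordant ::
    "('e::complex_banach \<Rightarrow> 'a::cstar_algebra \<Rightarrow> 'e) \<Rightarrow> ('e \<Rightarrow> 'e \<Rightarrow> 'a) \<Rightarrow> 'e set \<Rightarrow> 'e set \<Rightarrow> bool"
  where
  "concordant act ip M N \<longleftrightarrow>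
     closed_submodule act M \<and> closed_submodule act N \<and>
     orth_direct_sum ip (M \<inter> N) (closure (orth ip M + orth ip N))"


section \<open>Inner product spaces with explicit carrier, and their completion\<close>

text \<open>The Hilbert space obtained by localizing at a functional depends on that functional, so it is
  represented by a record with a carrier set instead of by a type.\<close>

record 'v ipspace =
  vecs :: "'v set"
  vadd :: "'v \<Rightarrow> 'v \<Rightarrow> 'v"
  vscale :: "complex \<Rightarrow> 'v \<Rightarrow> 'v"
  vinner :: "'v \<Rightarrow> 'v \<Rightarrow> complex"

definition vnorm :: "'v ipspace \<Rightarrow> 'v \<Rightarrow> real" where
  "vnorm V x = sqrt (Re (vinner V x x))"

definition vdist :: "'v ipspace \<Rightarrow> 'v \<Rightarrow> 'v \<Rightarrow> real" where
  "vdist V x y = vnorm V (vadd V x (vscale V (- 1) y))"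

definition vclosure :: "'v ipspace \<Rightarrow> 'v set \<Rightarrow> 'v set" where
  "vclosure V S = {x \<in> vecs V. \<forall>e>0. \<exists>y\<in>S. vdist V x y < e}"

definition vCauchy :: "'v ipspace \<Rightarrow> (nat \<Rightarrow> 'v) \<Rightarrow> bool" where
  "vCauchy V X \<longleftrightarrow>
     (\<forall>n. X n \<in> vecs V) \<and> (\<forall>e>0. \<exists>N. \<forall>m\<ge>N. \<forall>n\<ge>N. vdist V (X m) (X n) < e)"

definition cauchy_rel :: "'v ipspace \<Rightarrow> ((nat \<Rightarrow> 'v) \<times> (nat \<Rightarrow> 'v)) set" where
  "cauchy_rel V =
     {(X, Y). vCauchy V X \<and> vCauchy V Y \<and> (\<lambda>n. vdist V (X n) (Y n)) \<longlonglongrightarrow> 0}"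

text \<open>The metric completion: equivalence classes of Cauchy sequences, with termwise operations. The
  operations are independent of the representatives, so the unions below are over one and the same
  class, respectively one and the same singleton.\<close>

definition completion :: "'v ipspace \<Rightarrow> (nat \<Rightarrow> 'v) set ipspace" where
  "completion V =
     \<lparr> vecs = {X. vCauchy V X} // cauchy_rel V,
       vadd = (\<lambda>P Q. \<Union>X\<in>P. \<Union>Y\<in>Q. cauchy_rel V `` {\<lambda>n. vadd V (X n) (Y n)}),
       vscale = (\<lambda>c P. \<Union>X\<in>P. cauchy_rel V `` {\<lambda>n. vscale V c (X n)}),
       vinner = (\<lambda>P Q. the_elem (\<Union>X\<in>P. \<Union>Y\<in>Q. {lim (\<lambda>n. vinner V (X n) (Y n))})) \<rparr>"

definition to_completion :: "'v ipspace \<Rightarrow> 'v \<Rightarrow> (nat \<Rightarrow> 'v) set" where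
  "to_completion V x = cauchy_rel V `` {\<lambda>n. x}"

definition dixmier_cos :: "'v ipspace \<Rightarrow> 'v set \<Rightarrow> 'v set \<Rightarrow> real" where
  "dixmier_cos V M N =
     Sup {cmod (vinner V x y) | x y. x \<in> M \<and> y \<in> N \<and> vnorm V x \<le> 1 \<and> vnorm V y \<le> 1}"


section \<open>Localization at a positive functional\<close>

definition null_space ::
    "('e \<Rightarrow> 'e \<Rightarrow> 'a::cstar_algebra) \<Rightarrow> ('a \<Rightarrow> complex) \<Rightarrow> 'e set" where
  "null_space ip f = {x. f (ip x x) = 0}"

definition null_rel ::
    "('e::complex_banach \<Rightarrow> 'e \<Rightarrow> 'a::cstar_algebra) \<Rightarrow> ('a \<Rightarrow> complex) \<Rightarrow> ('e \<times> 'e) set" where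
  "null_rel ip f = {(x, y). x - y \<in> null_space ip f}"

definition quotient_space ::
    "('e::complex_banach \<Rightarrow> 'e \<Rightarrow> 'a::cstar_algebra) \<Rightarrow> ('a \<Rightarrow> complex) \<Rightarrow> 'e set ipspace" where
  "quotient_space ip f =
     \<lparr> vecs = UNIV // null_rel ip f,
       vadd = (\<lambda>P Q. \<Union>x\<in>P. \<Union>y\<in>Q. null_rel ip f `` {x + y}),
       vscale = (\<lambda>c P. \<Union>x\<in>P. null_rel ip f `` {scaleC c x}),
       vinner = (\<lambda>P Q. the_elem (\<Union>x\<in>P. \<Union>y\<in>Q. {f (ip x y)})) \<rparr>"

definition localization ::
    "('e::complex_banach \<Rightarrow> 'e \<Rightarrow> 'a::cstar_algebra) \<Rightarrow> ('a \<Rightarrow> complex) \<Rightarrow>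
       (nat \<Rightarrow> 'e set) set ipspace" where
  "localization ip f = completion (quotient_space ip f)"

definition localized_submodule ::
    "('e::complex_banach \<Rightarrow> 'e \<Rightarrow> 'a::cstar_algebra) \<Rightarrow> ('a \<Rightarrow> complex) \<Rightarrow> 'e set \<Rightarrow>
       (nat \<Rightarrow> 'e set) set set" where
  "localized_submodule ip f H =
     vclosure (localization ip f)
       ((\<lambda>x. to_completion (quotient_space ip f) (null_rel ip f `` {x})) ` H)"

text \<open>A nonzero algebra has a state. Over the zero algebra there is none, and the supremum is then
  an unspecified real number, but the zero module is the only Hilbert module over that algebra.\<close>

definition local_dixmier_cos ::
    "('e::complex_banach \<Rightarrow> 'e \<Rightarrow> 'a::cstar_algebra) \<Rightarrow> 'e set \<Rightarrow> 'e set \<Rightarrow> real" where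
  "local_dixmier_cos ip H K =
     (SUP f\<in>{f. state f}.
        dixmier_cos (localization ip f) (localized_submodule ip f H) (localized_submodule ip f K))"

end

theory Submission
  imports Defs
begin

text \<open>
  Write \<open>M\<close> and \<open>N\<close> for the two biorthogonal complements. The bound on the angle says that there is a
  constant \<open>c < 1\<close> with \<open>\<bar>f \<langle>x, y\<rangle>\<bar> \<le> c (f \<langle>x, x\<rangle>)\<^sup>1\<^sup>/\<^sup>2 (f \<langle>y, y\<rangle>)\<^sup>1\<^sup>/\<^sup>2\<close> for all states \<open>f\<close>, \<open>x \<in> M\<close> and
  \<open>y \<in> N\<close>. Expanding the square then gives \<open>(1 - c) f \<langle>x, x\<rangle> \<le> f \<langle>x + y, x + y\<rangle> \<le> \<parallel>x + y\<parallel>\<^sup>2\<close>. If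
  \<open>f\<close> is chosen to be norming for \<open>\<langle>x, x\<rangle>\<close>, the left side is \<open>(1 - c) \<parallel>x\<parallel>\<^sup>2\<close>; this is
  \<open>norm_square_le_if_local_dixmier_cos\<close>. So \<open>x\<close> is controlled by \<open>x + y\<close>, which forces \<open>M \<inter> N = {0}\<close>
  and makes \<open>M + N\<close> closed. Concordance of the orthogonal complements says precisely that the closure
  of \<open>M + N\<close> is orthogonally complemented, and the closure is \<open>M + N\<close> itself.

  The substantial ingredient is the norming state (\<open>norming_state\<close>): every nonzero positive \<open>a\<close> has a
  state with \<open>f a = \<parallel>a\<parallel>\<close>. It comes from the Hahn-Banach theorem for the sublinear functional that
  measures the distance of \<open>- x\<close> to the positive cone. A linear minorant of this distance is positive
  and has norm at most one; it can be chosen to attain the distance at \<open>a\<close>, and the distance of \<open>- a\<close>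
  to the cone is \<open>\<parallel>a\<parallel>\<close> because adding a positive element to a positive element does not decrease the
  norm.

  This monotonicity rests on the fact that every \<open>c\<^sup>* c\<close> lies in the convex cone of elements that are
  positive in a sense phrased through the norm (\<open>norm_positive_adj_mult_self\<close>). The argument below is Kaplansky's, but it avoids
  spectra. In a unital algebra a self-adjoint \<open>h\<close> counts as positive if \<open>\<parallel>t - h\<parallel> \<le> t\<close> for some
  \<open>t \<ge> 0\<close>, which is stable under sums; such elements have square roots, obtained by a fixed
  point iteration; and where the classical proof compares the spectra of \<open>d\<^sup>* d\<close> and \<open>d d\<^sup>*\<close>, it
  suffices to compare the growth of the powers of \<open>t + d\<^sup>* d\<close> and \<open>t + d d\<^sup>*\<close>. A unit is adjoined to the
  given algebra only to run this argument.
\<close>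

section \<open>Elementary consequences of the axioms\<close>

lemma scaleC_one [simp]: "scaleC 1 (x::'a::complex_banach) = x"
  using scaleC_of_real[of 1 x] by simp

lemma scaleC_zero_left [simp]: "scaleC 0 (x::'a::complex_banach) = 0"
  using scaleC_of_real[of 0 x] by simp

lemma scaleR_eq_scaleC: "scaleR r (x::'a::complex_banach) = scaleC (complex_of_real r) x"
  by (simp add: scaleC_of_real)

lemma scaleC_zero_right [simp]: "scaleC c (0::'a::complex_banach) = 0"
  using scaleC_add_right[of c 0 "0::'a"] by simp

lemma scaleC_minus_right: "scaleC c (- x::'a::complex_banach) = - scaleC c x"
  using scaleC_add_right[of c x "-x"] by (simp add: eq_neg_iff_add_eq_0 add.commute)

lemma scaleC_minus_left: "scaleC (- c) (x::'a::complex_banach) = - scaleC c x"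
  using scaleC_add_left[of c "-c" x] by (simp add: eq_neg_iff_add_eq_0 add.commute)

lemma scaleC_diff_right: "scaleC c (x - y::'a::complex_banach) = scaleC c x - scaleC c y"
  using scaleC_add_right[of c x "-y"] by (simp add: scaleC_minus_right)

lemma scaleC_scaleR_commute: "scaleC c (scaleR r (x::'a::complex_banach)) = scaleR r (scaleC c x)"
  by (simp add: scaleR_eq_scaleC scaleC_scaleC mult.commute)

lemma bounded_linear_scaleC: "bounded_linear (scaleC c :: 'a::complex_banach \<Rightarrow> 'a)"
  by (rule bounded_linear_intro[where K = "cmod c"])
     (simp_all add: scaleC_add_right scaleC_scaleR_commute norm_scaleC mult.commute)

lemma adj_zero [simp]: "adj (0::'a::cstar_algebra) = 0"
  using adj_add[of 0 "0::'a"] by simp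

lemma adj_minus: "adj (- x::'a::cstar_algebra) = - adj x"
  using adj_add[of x "-x"] by (simp add: eq_neg_iff_add_eq_0 add.commute)

lemma adj_diff: "adj (x - y::'a::cstar_algebra) = adj x - adj y"
  using adj_add[of x "-y"] by (simp add: adj_minus)

lemma adj_scaleR: "adj (scaleR r (x::'a::cstar_algebra)) = scaleR r (adj x)"
  by (simp add: scaleR_eq_scaleC adj_scaleC)

lemma norm_adj [simp]: "norm (adj (x::'a::cstar_algebra)) = norm x"
proof -
  have le: "norm a \<le> norm (adj a)" for a :: 'a
  proof (cases "a = 0")
    case False
    have "(norm a)\<^sup>2 \<le> norm (adj a) * norm a"
      using norm_mult_ineq[of "adj a" a] by (simp add: cstar_identity)
    then show ?thesis using False by (simp add: power2_eq_square)
  qed simp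
  show ?thesis using le[of x] le[of "adj x"] by (simp add: adj_adj)
qed

lemma bounded_linear_adj: "bounded_linear (adj :: 'a::cstar_algebra \<Rightarrow> 'a)"
  by (rule bounded_linear_intro[where K = 1]) (simp_all add: adj_add adj_scaleR)

lemma norm_square_selfadjoint: "adj x = x \<Longrightarrow> norm (x * x) = (norm (x::'a::cstar_algebra))\<^sup>2"
  using cstar_identity[of x] by simp

class unital_cstar_algebra = cstar_algebra + real_normed_algebra_1

lemma adj_one [simp]: "adj (1::'a::unital_cstar_algebra) = 1"
  by (metis adj_adj adj_mult mult_1 mult_1_right)

lemma adj_of_real [simp]: "adj (of_real t :: 'a::unital_cstar_algebra) = of_real t"
  by (simp add: of_real_def adj_scaleR)

lemma adj_power: "adj (x ^ n) = adj (x::'a::unital_cstar_algebra) ^ n"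
  by (induction n) (simp_all add: adj_mult power_commutes)

lemma norm_power_two_power_selfadjoint:
  "adj x = x \<Longrightarrow> norm (x ^ (2 ^ n)) = norm (x::'a::unital_cstar_algebra) ^ (2 ^ n)"
proof (induction n)
  case (Suc n)
  have "norm (x ^ 2 ^ Suc n) = norm (x ^ 2 ^ n * x ^ 2 ^ n)"
    by (simp add: mult_2 power_add)
  also have "\<dots> = (norm (x ^ 2 ^ n))\<^sup>2"
    using Suc.prems by (intro norm_square_selfadjoint) (simp add: adj_power)
  finally show ?case using Suc by (simp add: power2_eq_square mult_2 power_add)
qed simp

section \<open>Positivity and square roots in unital C*-algebras\<close>

text \<open>The element \<open>g\<close> is the limit of the iteration for the fixed point equation
  \<open>g = (y + g\<^sup>2) / 2\<close>. Each increment of the iteration in the algebra is dominated by the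
  increment of the same iteration started for the real number \<open>1\<close> in place of \<open>y\<close>; that one is
  increasing and bounded, so convergence holds even in the boundary case \<open>\<parallel>y\<parallel> = 1\<close>.\<close>

lemma sqrt_one_minus:
  fixes y :: "'a::unital_cstar_algebra"
  assumes sa: "adj y = y" and le: "norm y \<le> 1"
  obtains g where "adj g = g" "norm g \<le> 1" "(1 - g) * (1 - g) = 1 - y"
    "\<And>z. z * y = y * z \<Longrightarrow> z * g = g * z"
proof -
  define G where "G = rec_nat 0 (\<lambda>_ x. (1/2) *\<^sub>R (y + x * x))"
  define r where "r = rec_nat 0 (\<lambda>_ x. (1/2) * (1 + x * x :: real))"
  have G_simps [simp]: "G 0 = 0" "G (Suc n) = (1/2) *\<^sub>R (y + G n * G n)" for n
    by (simp_all add: G_def)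
  have r_simps [simp]: "r 0 = 0" "r (Suc n) = (1/2) * (1 + r n * r n)" for n
    by (simp_all add: r_def)
  have r01: "0 \<le> r n \<and> r n \<le> 1" for n
  proof (induction n)
    case (Suc n)
    then have "r n * r n \<le> 1" by (simp add: mult_le_one)
    then show ?case using Suc by simp
  qed simp
  have r_inc: "r n \<le> r (Suc n)" for n
    using sum_squares_bound[of 1 "r n"] by (simp add: power2_eq_square)
  have G_adj: "adj (G n) = G n" for n
    by (induction n) (simp_all add: adj_scaleR adj_add adj_mult sa)
  have G_comm: "z * G n = G n * z" if "z * y = y * z" for z n
  proof (induction n)
    case (Suc n)
    have "z * (G n * G n) = G n * G n * z" by (metis Suc mult.assoc)
    then show ?case using that by (simp add: algebra_simps)
  qed simp
  have G_norm: "norm (G n) \<le> r n" for n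
  proof (induction n)
    case (Suc n)
    have "norm (y + G n * G n) \<le> 1 + r n * r n"
      using le Suc r01[of n]
      by (intro order_trans[OF norm_triangle_ineq] add_mono order_trans[OF norm_mult_ineq] mult_mono)
         auto
    then show ?case by simp
  qed simp
  have G_diff: "norm (G (Suc n) - G n) \<le> r (Suc n) - r n" for n
  proof (induction n)
    case 0 then show ?case using le by simp
  next
    case (Suc n)
    have "G (Suc n) * G n = G n * G (Suc n)" by (rule G_comm) (rule G_comm[symmetric], simp)
    then have *: "G (Suc n) * G (Suc n) - G n * G n = (G (Suc n) - G n) * (G (Suc n) + G n)"
      by (simp only: ring_distribs) simp
    have "G (Suc (Suc n)) - G (Suc n) = (1/2) *\<^sub>R (G (Suc n) * G (Suc n) - G n * G n)"
      unfolding G_simps(2)[of "Suc n"] by (subst (3) G_simps(2)) (simp only: scaleR_diff_right[symmetric], simp)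
    then have "norm (G (Suc (Suc n)) - G (Suc n)) = (1/2) * norm ((G (Suc n) - G n) * (G (Suc n) + G n))"
      using * by simp
    also have "\<dots> \<le> (1/2) * ((r (Suc n) - r n) * (r (Suc n) + r n))"
      using Suc r_inc[of n] G_norm
      by (intro mult_left_mono order_trans[OF norm_mult_ineq] mult_mono
          order_trans[OF norm_triangle_ineq] add_mono) (auto simp del: G_simps r_simps)
    also have "\<dots> = r (Suc (Suc n)) - r (Suc n)"
      using r_simps(2)[of n] r_simps(2)[of "Suc n"] by (simp add: algebra_simps del: r_simps)
    finally show ?case .
  qed
  have "convergent r"
    using r_inc r01 by (intro Bseq_monoseq_convergent BseqI'[where K = 1])
      (auto simp: monoseq_Suc simp del: r_simps)
  then have "summable (\<lambda>n. r (Suc n) - r n)"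
    by (auto simp: convergent_def simp del: r_simps intro: telescope_summable)
  then have "summable (\<lambda>n. G (Suc n) - G n)"
    by (rule summable_comparison_test') (rule G_diff)
  then have "convergent (\<lambda>n. \<Sum>k<n. G (Suc k) - G k)"
    by (simp add: summable_iff_convergent)
  then obtain g where g: "G \<longlonglongrightarrow> g"
    unfolding sum_lessThan_telescope convergent_def by auto
  show ?thesis
  proof
    show "adj g = g"
      using bounded_linear.tendsto[OF bounded_linear_adj g] g
      by (simp add: G_adj LIMSEQ_unique)
    show "norm g \<le> 1"
      by (rule LIMSEQ_le_const2[OF tendsto_norm[OF g]])
         (use G_norm r01 order_trans in blast)
    have "(\<lambda>n. G (Suc n)) \<longlonglongrightarrow> (1/2) *\<^sub>R (y + g * g)"
      unfolding G_simps by (intro tendsto_intros g)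
    then have "g = (1/2) *\<^sub>R (y + g * g)"
      using LIMSEQ_Suc[OF g] LIMSEQ_unique by blast
    then have "2 *\<^sub>R g = y + g * g" by (metis scaleR_half_double scaleR_2 real_vector.scale_left_commute scaleR_2)
    then show "(1 - g) * (1 - g) = 1 - y"
      by (simp add: algebra_simps scaleR_2)
    show "z * g = g * z" if "z * y = y * z" for z
      using tendsto_mult[OF tendsto_const[of z] g] tendsto_mult[OF g tendsto_const[of z]]
      by (simp add: G_comm[OF that] LIMSEQ_unique)
  qed
qed

text \<open>Since \<open>p\<close> and \<open>q\<close> commute, \<open>u = p + \<i> q\<close> satisfies \<open>u\<^sup>* u = t\<close>, so \<open>u\<close> has norm \<open>\<surd>t\<close>, and \<open>q\<close> is the
  imaginary part of \<open>u\<close>.\<close>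

lemma norm_le_if_squares_sum:
  fixes p q :: "'a::unital_cstar_algebra"
  assumes "adj p = p" "adj q = q" "p * q = q * p" "p * p + q * q = of_real t" "0 \<le> t"
  shows "(norm q)\<^sup>2 \<le> t"
proof -
  define u where "u = p + scaleC \<i> q"
  have adj_u: "adj u = p - scaleC \<i> q"
    by (simp add: u_def adj_add adj_scaleC assms scaleC_minus_left)
  have "adj u * u = p * p + q * q"
    unfolding adj_u unfolding u_def
    by (simp add: ring_distribs scaleC_mult_left scaleC_mult_right scaleC_scaleC assms(3)
        scaleC_minus_left scaleC_add_right scaleC_diff_right)
  then have norm_u: "(norm u)\<^sup>2 = \<bar>t\<bar>"
    using cstar_identity[of u] assms(4) by simp
  have "scaleC (2 * \<i>) q = u - adj u"
    unfolding adj_u using scaleC_add_left[of \<i> \<i> q] by (simp add: u_def)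
  then have "2 * norm q = norm (u - adj u)" using norm_scaleC[of "2 * \<i>" q] by (simp add: norm_mult)
  also have "\<dots> \<le> 2 * norm u" using norm_triangle_ineq4[of u "adj u"] by simp
  finally have "(norm q)\<^sup>2 \<le> (norm u)\<^sup>2" by (simp add: power_mono)
  then show ?thesis using norm_u \<open>0 \<le> t\<close> by simp
qed

lemma of_real_minus_square_is_square:
  fixes k :: "'a::unital_cstar_algebra"
  assumes sa: "adj k = k" and t: "(norm k)\<^sup>2 \<le> t"
  obtains q where "adj q = q" "q * q = of_real t - k * k" "q * k = k * q"
proof (cases "t = 0")
  case True
  then have "k = 0" using t by simp
  then show ?thesis using True that[of 0] by simp
next
  case False
  then have "t > 0" using t by (smt (verit) zero_le_power2)
  define y where "y = (1/t) *\<^sub>R (k * k)"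
  have "adj y = y" by (simp add: y_def adj_scaleR adj_mult sa)
  moreover have "norm y \<le> 1" using t \<open>t > 0\<close> by (simp add: y_def norm_square_selfadjoint sa)
  ultimately obtain g where g: "adj g = g" "(1 - g) * (1 - g) = 1 - y"
    and comm: "\<And>z. z * y = y * z \<Longrightarrow> z * g = g * z"
    by (rule sqrt_one_minus) blast
  have kg: "k * g = g * k" by (rule comm) (simp add: y_def mult.assoc)
  show ?thesis
  proof
    show "adj (sqrt t *\<^sub>R (1 - g)) = sqrt t *\<^sub>R (1 - g)"
      by (simp add: adj_scaleR adj_diff g)
    show "(sqrt t *\<^sub>R (1 - g)) * (sqrt t *\<^sub>R (1 - g)) = of_real t - k * k"
      using \<open>t > 0\<close> by (simp add: g(2)) (simp add: y_def of_real_def scaleR_diff_right)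
    show "(sqrt t *\<^sub>R (1 - g)) * k = k * (sqrt t *\<^sub>R (1 - g))"
      by (simp add: algebra_simps kg)
  qed
qed

lemma norm_of_real_minus_square_le:
  fixes k :: "'a::unital_cstar_algebra"
  assumes "adj k = k" "(norm k)\<^sup>2 \<le> t"
  shows "norm (of_real t - k * k) \<le> t"
proof -
  obtain q where q: "adj q = q" "q * q = of_real t - k * k" "q * k = k * q"
    using assms by (rule of_real_minus_square_is_square)
  have "0 \<le> t" using assms(2) by (smt (verit) zero_le_power2)
  then have "(norm q)\<^sup>2 \<le> t"
    using assms q by (intro norm_le_if_squares_sum[of k]) auto
  then show ?thesis using norm_square_selfadjoint[OF q(1)] q(2) by simp
qed

text \<open>In spectral terms the condition says that the spectrum of \<open>h\<close> lies in \<open>[0, 2 t]\<close>. Stated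
  through the norm it is stable under sums by the triangle inequality alone.\<close>

definition norm_positive :: "'a::unital_cstar_algebra \<Rightarrow> bool" where
  "norm_positive h \<longleftrightarrow> adj h = h \<and> (\<exists>t\<ge>0. norm (of_real t - h) \<le> t)"

lemma norm_positive_selfadjoint: "norm_positive h \<Longrightarrow> adj h = h"
  by (simp add: norm_positive_def)

lemma norm_positive_zero: "norm_positive 0"
  by (auto simp: norm_positive_def intro: exI[of _ 0])

lemma norm_positive_add:
  assumes "norm_positive h" "norm_positive k"
  shows "norm_positive (h + k)"
proof -
  obtain s t where st: "0 \<le> s" "norm (of_real s - h) \<le> s" "0 \<le> t" "norm (of_real t - k) \<le> t"
    using assms by (auto simp: norm_positive_def)
  have "of_real (s + t) - (h + k) = (of_real s - h) + (of_real t - k)" by simp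
  then have "norm (of_real (s + t) - (h + k)) \<le> s + t"
    using st norm_triangle_ineq[of "of_real s - h" "of_real t - k"] by (metis add_mono order_trans)
  then show ?thesis
    using assms st unfolding norm_positive_def by (metis adj_add add_nonneg_nonneg)
qed

lemma norm_positive_scaleR:
  assumes "norm_positive h" "0 \<le> r"
  shows "norm_positive (r *\<^sub>R h)"
proof -
  obtain t where t: "0 \<le> t" "norm (of_real t - h) \<le> t"
    using assms by (auto simp: norm_positive_def)
  have "of_real (r * t) - r *\<^sub>R h = r *\<^sub>R (of_real t - h)"
    by (simp add: scaleR_diff_right of_real_def)
  then have "norm (of_real (r * t) - r *\<^sub>R h) \<le> r * t"
    using t assms(2) by (simp add: mult_left_mono)
  then show ?thesis
    using assms t unfolding norm_positive_def by (metis adj_scaleR mult_nonneg_nonneg)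
qed

lemma norm_positive_square:
  assumes "adj k = k"
  shows "norm_positive (k * k)"
  using norm_of_real_minus_square_le[OF assms order_refl]
  by (auto simp: norm_positive_def adj_mult assms intro!: exI[of _ "(norm k)\<^sup>2"])

text \<open>With \<open>y = 1 - h / t\<close> the root is \<open>\<surd>t (1 - g)\<close> for the \<open>g\<close> of the preceding construction, and the
  bound \<open>\<parallel>g\<parallel> \<le> 1\<close> is exactly what makes the root positive again.\<close>

lemma norm_positive_sqrt:
  assumes "norm_positive h"
  obtains r where "norm_positive r" "r * r = h" "\<And>z. z * h = h * z \<Longrightarrow> z * r = r * z"
proof -
  obtain t where t: "0 \<le> t" "norm (of_real t - h) \<le> t" and sa: "adj h = h"
    using assms by (auto simp: norm_positive_def)
  show ?thesis
  proof (cases "t = 0")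
    case True
    then show ?thesis using t that[OF norm_positive_zero] by simp
  next
    case False
    with t have "t > 0" by simp
    define y where "y = (1/t) *\<^sub>R (of_real t - h)"
    have "adj y = y" by (simp add: y_def adj_scaleR adj_diff sa)
    moreover have "norm y \<le> 1" using t \<open>t > 0\<close> by (simp add: y_def)
    ultimately obtain g where g: "adj g = g" "norm g \<le> 1" "(1 - g) * (1 - g) = 1 - y"
      and comm: "\<And>z. z * y = y * z \<Longrightarrow> z * g = g * z"
      by (rule sqrt_one_minus) blast
    define r where "r = sqrt t *\<^sub>R (1 - g)"
    show ?thesis
    proof
      have "adj r = r" by (simp add: r_def adj_scaleR adj_diff g)
      moreover have "of_real (sqrt t) - r = sqrt t *\<^sub>R g"
        by (simp add: r_def of_real_def scaleR_diff_right)
      then have "norm (of_real (sqrt t) - r) \<le> sqrt t"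
        using g(2) \<open>t > 0\<close> by (simp add: mult_left_le)
      ultimately show "norm_positive r"
        using \<open>t > 0\<close> unfolding norm_positive_def by (metis less_imp_le real_sqrt_gt_zero)
      show "r * r = h"
        using \<open>t > 0\<close> by (simp add: r_def g(3)) (simp add: y_def of_real_def scaleR_diff_right)
      show "z * r = r * z" if "z * h = h * z" for z
      proof -
        have "z * y = y * z" using that by (simp add: y_def algebra_simps of_real_def)
        then show ?thesis using comm by (simp add: r_def algebra_simps)
      qed
    qed
  qed
qed

lemma power_two_power_le_linear_imp_le_one:
  fixes x :: real
  assumes "0 \<le> x" "\<And>k. x ^ (2 ^ k) \<le> 2 ^ k + 1"
  shows "x \<le> 1"
proof (rule ccontr)
  assume "\<not> x \<le> 1"
  then have x: "x > 1" by simp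
  have "(\<lambda>n. real n / x ^ n) \<longlonglongrightarrow> 0"
    using lim_n_over_pown[of x] x by simp
  moreover have "(\<lambda>n. 1 / x ^ n) \<longlonglongrightarrow> 0" using LIMSEQ_inverse_realpow_zero[OF x] by (simp add: divide_inverse)
  ultimately have "(\<lambda>n. real n / x ^ n + 1 / x ^ n) \<longlonglongrightarrow> 0 + 0" by (rule tendsto_add)
  then have "eventually (\<lambda>n. real n / x ^ n + 1 / x ^ n < 1) sequentially"
    by (intro order_tendstoD(2)) auto
  then obtain N where N: "\<And>n. n \<ge> N \<Longrightarrow> real n / x ^ n + 1 / x ^ n < 1"
    by (auto simp: eventually_sequentially)
  have "real (2 ^ N) / x ^ (2 ^ N) + 1 / x ^ (2 ^ N) < 1"
    by (rule N) (simp add: less_imp_le)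
  then have "2 ^ N + 1 < x ^ (2 ^ N)"
    using x by (simp add: field_simps)
  then show False using assms(2)[of N] by simp
qed

text \<open>Let \<open>t = \<parallel>d\<parallel>\<^sup>2\<close> and \<open>z = d d\<^sup>*\<close>. Twice \<open>d d\<^sup>* + d\<^sup>* d\<close> is the sum of the squares of \<open>d + d\<^sup>*\<close> and
  \<open>\<i> (d - d\<^sup>*)\<close>; adding \<open>- d\<^sup>* d = w\<^sup>2\<close> to \<open>d d\<^sup>* + d\<^sup>* d\<close> shows that \<open>z\<close> is positive, whence
  \<open>\<parallel>t - z\<parallel> \<le> t\<close>. On the other hand \<open>d\<^sup>* d = - w\<^sup>2\<close> gives \<open>\<parallel>t + d\<^sup>* d\<parallel> \<le> t\<close>. Because
  \<open>(t + z) d = d (t + d\<^sup>* d)\<close>, the powers of \<open>t + z\<close> exceed those of \<open>t\<close> by a linear factor at most; as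
  \<open>t + z\<close> is self-adjoint, this gives \<open>\<parallel>t + z\<parallel> \<le> t\<close>. Subtracting the squares of \<open>t + z\<close> and \<open>t - z\<close>
  yields \<open>4 t \<parallel>z\<parallel> \<le> 2 t\<^sup>2\<close>, which contradicts \<open>\<parallel>z\<parallel> = t\<close> unless \<open>t = 0\<close>.\<close>

lemma eq_zero_if_neg_square:
  fixes d w :: "'a::unital_cstar_algebra"
  assumes w: "adj w = w" and d: "adj d * d = - (w * w)"
  shows "d = 0"
proof -
  define t where "t = (norm d)\<^sup>2"
  define z where "z = d * adj d"
  have t0: "0 \<le> t" by (simp add: t_def)
  have adj_z: "adj z = z" by (simp add: z_def adj_mult adj_adj)
  have norm_z: "norm z = t"
    using cstar_identity[of "adj d"] by (simp add: z_def t_def adj_adj)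
  have norm_w: "(norm w)\<^sup>2 = t"
    using norm_square_selfadjoint[OF w] cstar_identity[of d] d by (simp add: t_def)
  have plus: "norm (of_real t + adj d * d) \<le> t"
    using norm_of_real_minus_square_le[of w t] w norm_w d by simp
  have minus: "norm (of_real t - z) \<le> t"
  proof -
    define a where "a = d + adj d"
    define b where "b = scaleC \<i> (d - adj d)"
    have adj_ab: "adj a = a" "adj b = b"
      by (simp_all add: a_def b_def adj_add adj_adj adj_scaleC adj_diff scaleC_minus_left
          add.commute flip: scaleC_minus_right)
    have "a * a + b * b = 2 *\<^sub>R (z + adj d * d)"
      by (simp add: a_def b_def z_def scaleC_mult_left scaleC_mult_right scaleC_scaleC scaleC_minus_left
          scaleC_diff_right algebra_simps scaleR_2)
    then have "z = (1/2) *\<^sub>R (a * a + b * b) + w * w" using d by (simp add: scaleR_diff_right)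
    then have "norm_positive z"
      using adj_ab w by (metis norm_positive_add norm_positive_scaleR norm_positive_square
          zero_le_divide_1_iff zero_le_numeral)
    then obtain e where e: "norm_positive e" "e * e = z" by (rule norm_positive_sqrt)
    then have "(norm e)\<^sup>2 = t"
      using norm_z norm_square_selfadjoint[OF norm_positive_selfadjoint[OF e(1)]] by simp
    then show ?thesis
      using norm_of_real_minus_square_le[OF norm_positive_selfadjoint[OF e(1)], of t] e(2) by simp
  qed
  \<comment> \<open>the substitute for comparing the spectra of \<open>d d\<^sup>*\<close> and \<open>d\<^sup>* d\<close>\<close>
  have intertwine: "(of_real t + z) ^ n * d = d * (of_real t + adj d * d) ^ n" for n
  proof (induction n)
    case (Suc n)
    have "(of_real t + z) ^ Suc n * d = (of_real t + z) ^ n * ((of_real t + z) * d)"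
      by (simp only: power_Suc2 mult.assoc)
    also have "(of_real t + z) * d = d * (of_real t + adj d * d)"
      by (simp add: z_def of_real_def algebra_simps)
    finally show ?case using Suc by (simp add: mult.assoc[symmetric] power_commutes)
        (simp add: mult.assoc power_commutes)
  qed simp
  have grow: "norm ((of_real t + z) ^ n) \<le> (real n + 1) * t ^ n" for n
  proof (induction n)
    case (Suc n)
    have "(of_real t + z) ^ Suc n = (of_real t + z) ^ n * (of_real t + z)" by (simp only: power_Suc2)
    also have "\<dots> = t *\<^sub>R (of_real t + z) ^ n + d * (of_real t + adj d * d) ^ n * adj d"
      unfolding intertwine[symmetric] by (simp add: distrib_left of_real_def) (simp add: z_def mult.assoc)
    finally have "norm ((of_real t + z) ^ Suc n)
        \<le> t * norm ((of_real t + z) ^ n) + norm (d * (of_real t + adj d * d) ^ n * adj d)"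
      using t0 by (metis norm_triangle_ineq norm_scaleR abs_of_nonneg)
    also have "norm (d * (of_real t + adj d * d) ^ n * adj d) \<le> norm d * t ^ n * norm d"
      using plus t0
      by (intro order_trans[OF norm_mult_ineq] mult_mono order_trans[OF norm_power_ineq] power_mono) auto
    also have "\<dots> = t * t ^ n" by (simp add: t_def power2_eq_square)
    also have "t * norm ((of_real t + z) ^ n) \<le> t * ((real n + 1) * t ^ n)"
      using Suc t0 by (rule mult_left_mono)
    finally show ?case by (simp add: algebra_simps)
  qed simp
  have "t = 0"
  proof (rule ccontr)
    assume "t \<noteq> 0"
    then have t: "t > 0" using t0 by simp
    have adj_tz: "adj (of_real t + z) = of_real t + z" "adj (of_real t - z) = of_real t - z"
      by (simp_all add: adj_add adj_diff adj_z)
    have "norm (of_real t + z) / t \<le> 1"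
    proof (rule power_two_power_le_linear_imp_le_one)
      fix k
      show "(norm (of_real t + z) / t) ^ 2 ^ k \<le> 2 ^ k + 1"
        using grow[of "2 ^ k"] t
        by (simp add: norm_power_two_power_selfadjoint[OF adj_tz(1)] power_divide divide_le_eq)
    qed (use t in simp)
    then have "(norm (of_real t + z))\<^sup>2 \<le> t\<^sup>2" using t by (simp add: power_mono)
    moreover have "(norm (of_real t - z))\<^sup>2 \<le> t\<^sup>2" using minus by (simp add: power_mono)
    moreover have "(of_real t + z) * (of_real t + z) - (of_real t - z) * (of_real t - z) = (4 * t) *\<^sub>R z"
      by (simp add: of_real_def algebra_simps) (simp flip: scaleR_add_left)
    then have "4 * t * norm z \<le> (norm (of_real t + z))\<^sup>2 + (norm (of_real t - z))\<^sup>2"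
      using norm_triangle_ineq4[of "(of_real t + z) * (of_real t + z)" "(of_real t - z) * (of_real t - z)"] t
      by (simp add: norm_square_selfadjoint adj_tz)
    moreover have "0 < t * t" using t by simp
    ultimately show False using norm_z by (simp add: power2_eq_square mult.assoc)
  qed
  then show ?thesis by (simp add: t_def)
qed

text \<open>For \<open>h = c\<^sup>* c\<close> let \<open>r = \<bar>h\<bar>\<close> be the root of \<open>h\<^sup>2\<close>, \<open>m\<close> the root of \<open>r\<close> and \<open>n = r - h\<close>, twice the
  negative part of \<open>h\<close>. Then \<open>n h = - r n\<close>, so \<open>(c n)\<^sup>* (c n) = n h n = - (m n)\<^sup>2\<close>, whence \<open>c n = 0\<close> by
  the preceding lemma. This leads to \<open>n = 0\<close>, that is, \<open>h = \<bar>h\<bar>\<close>.\<close>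

lemma norm_positive_adj_mult_self: "norm_positive (adj c * c)"
  for c :: "'a::unital_cstar_algebra"
proof -
  define h where "h = adj c * c"
  have sa: "adj h = h" by (simp add: h_def adj_mult adj_adj)
  obtain r where r: "norm_positive r" "r * r = h * h"
    and comm_r: "\<And>z. z * (h * h) = h * h * z \<Longrightarrow> z * r = r * z"
    using norm_positive_sqrt[OF norm_positive_square[OF sa]] by blast
  have hr: "h * r = r * h" by (rule comm_r) (simp add: mult.assoc)
  obtain m where m: "norm_positive m" "m * m = r"
    and comm_m: "\<And>z. z * r = r * z \<Longrightarrow> z * m = m * z"
    using norm_positive_sqrt[OF r(1)] by blast
  define n where "n = r - h"
  have adj_n: "adj n = n" by (simp add: n_def adj_diff sa norm_positive_selfadjoint r)
  have "n * r = r * n" by (simp add: n_def algebra_simps hr)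
  then have nm: "n * m = m * n" by (rule comm_m)
  have nh: "n * h = - (r * n)" by (simp add: n_def algebra_simps r(2))
  have "n * h * n = - (m * n * (m * n))"
    unfolding nh by (metis m(2) mult.assoc mult_minus_left nm)
  then have "adj (c * n) * (c * n) = - ((m * n) * (m * n))"
    by (simp add: adj_mult adj_n h_def mult.assoc)
  moreover have adj_mn: "adj (m * n) = m * n"
    by (simp add: adj_mult adj_n nm norm_positive_selfadjoint m)
  ultimately have "c * n = 0" by (intro eq_zero_if_neg_square) auto
  with \<open>adj (c * n) * (c * n) = - ((m * n) * (m * n))\<close> have "(m * n) * (m * n) = 0" by simp
  then have "m * n = 0" using norm_square_selfadjoint[OF adj_mn] by simp
  then have rn: "r * n = 0" using m(2) by (metis mult.assoc mult_zero_right)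
  then have "n * n = 0" using nh by (simp add: n_def algebra_simps hr)
  then have "n = 0" using norm_square_selfadjoint[OF adj_n] by simp
  then show ?thesis using r(1) by (simp add: n_def h_def)
qed

text \<open>For \<open>t = \<parallel>a + s\<parallel>\<close>, the element \<open>t - a = (t - (a + s)) + s\<close> is positive. Its root and the root of
  \<open>a\<close> commute and their squares add up to \<open>t\<close>.\<close>

lemma norm_mono_norm_positive:
  fixes a s :: "'a::unital_cstar_algebra"
  assumes a: "norm_positive a" and s: "norm_positive s"
  shows "norm a \<le> norm (a + s)"
proof -
  define t where "t = norm (a + s)"
  obtain k where k: "norm_positive k" "k * k = a + s"
    using norm_positive_sqrt[OF norm_positive_add[OF a s]] by blast
  have adj_k: "adj k = k" using k(1) by (rule norm_positive_selfadjoint)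
  have "(norm k)\<^sup>2 = t" using norm_square_selfadjoint[OF adj_k] k(2) by (simp add: t_def)
  then obtain p where p: "adj p = p" "p * p = of_real t - (a + s)"
    using of_real_minus_square_is_square[OF adj_k, of t] k(2) by auto
  have "norm_positive (of_real t - a)"
    using norm_positive_add[OF norm_positive_square[OF p(1)] s] p(2) by simp
  then obtain q where q: "norm_positive q" "q * q = of_real t - a"
    and comm_q: "\<And>z. z * (of_real t - a) = (of_real t - a) * z \<Longrightarrow> z * q = q * z"
    using norm_positive_sqrt by blast
  obtain b where b: "norm_positive b" "b * b = a"
    and comm_b: "\<And>z. z * a = a * z \<Longrightarrow> z * b = b * z"
    using norm_positive_sqrt[OF a] by blast
  have "a * q = q * a" by (rule comm_q) (simp add: algebra_simps of_real_def)
  then have "q * b = b * q" by (intro comm_b) simp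
  then have "(norm b)\<^sup>2 \<le> t"
    using q b by (intro norm_le_if_squares_sum[of q]) (auto simp: norm_positive_selfadjoint t_def)
  then show ?thesis
    using norm_square_selfadjoint[OF norm_positive_selfadjoint[OF b(1)]] b(2) by (simp add: t_def)
qed

section \<open>Adjoining a unit\<close>

text \<open>The unitization carries the larger of two C*-seminorms: the operator norm of left multiplication on
  the original algebra, and the modulus of the scalar part. The operator norm alone would only be a
  seminorm when the original algebra already has a unit.\<close>

datatype 'a unitization = Unitize (alg_part: 'a) (scalar_part: complex)

lemma unitization_eqI:
  "alg_part u = alg_part v \<Longrightarrow> scalar_part u = scalar_part v \<Longrightarrow> u = v"
  by (cases u; cases v) simp

definition left_action :: "'a::cstar_algebra unitization \<Rightarrow> 'a \<Rightarrow> 'a" where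
  "left_action u x = alg_part u * x + scaleC (scalar_part u) x"

lemma bounded_linear_left_action: "bounded_linear (left_action u)"
  unfolding left_action_def
  by (intro bounded_linear_add bounded_linear_scaleC bounded_linear_mult_right)

instantiation unitization :: (cstar_algebra) real_vector
begin

definition "0 = Unitize 0 0"
definition "u + v = Unitize (alg_part u + alg_part v) (scalar_part u + scalar_part v)"
definition "- u = Unitize (- alg_part u) (- scalar_part u)"
definition "u - v = Unitize (alg_part u - alg_part v) (scalar_part u - scalar_part v)"
definition "scaleR r u = Unitize (scaleR r (alg_part u)) (scaleR r (scalar_part u))"

instance
  by standard
    (simp_all add: zero_unitization_def plus_unitization_def uminus_unitization_def
      minus_unitization_def scaleR_unitization_def scaleR_add_right scaleR_add_left)

end

lemma parts_simps [simp]: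
  "alg_part 0 = 0" "scalar_part 0 = 0"
  "alg_part (u + v) = alg_part u + alg_part v" "scalar_part (u + v) = scalar_part u + scalar_part v"
  "alg_part (- u) = - alg_part u" "scalar_part (- u) = - scalar_part u"
  "alg_part (u - v) = alg_part u - alg_part v" "scalar_part (u - v) = scalar_part u - scalar_part v"
  "alg_part (scaleR r u) = scaleR r (alg_part u)" "scalar_part (scaleR r u) = scaleR r (scalar_part u)"
  for u v :: "'a::cstar_algebra unitization"
  by (simp_all add: zero_unitization_def plus_unitization_def uminus_unitization_def
      minus_unitization_def scaleR_unitization_def)

text \<open>The C*-identity makes left multiplication isometric: test it on the adjoint.\<close>

lemma norm_le_if_mult_le:
  fixes a :: "'a::cstar_algebra"
  assumes "\<And>x. norm (a * x) \<le> c * norm x" "0 \<le> c"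
  shows "norm a \<le> c"
proof (cases "a = 0")
  case False
  have "norm (a * adj a) \<le> c * norm a" using assms(1)[of "adj a"] by simp
  then have "norm a * norm a \<le> c * norm a"
    using cstar_identity[of "adj a"] by (simp add: adj_adj power2_eq_square)
  then show ?thesis using False by simp
qed (use assms in simp)

instantiation unitization :: (cstar_algebra) real_normed_vector
begin

definition "norm u = max (cmod (scalar_part u)) (onorm (left_action u))"
definition "dist u v = norm (u - v)" for u v :: "'a unitization"
definition "sgn u = scaleR (inverse (norm u)) u" for u :: "'a unitization"
definition "uniformity = (INF e\<in>{0<..}. principal {(u :: 'a unitization, v). dist u v < e})"
definition "open U \<longleftrightarrow> (\<forall>u::'a unitization\<in>U. eventually (\<lambda>(u', v). u' = u \<longrightarrow> v \<in> U) uniformity)"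

instance
proof
  fix u v :: "'a unitization" and r :: real
  have act_add: "left_action (u + v) = (\<lambda>x. left_action u x + left_action v x)"
    by (rule ext) (simp add: left_action_def ring_distribs scaleC_add_left)
  have act_scale: "left_action (r *\<^sub>R u) = (\<lambda>x. r *\<^sub>R left_action u x)"
    by (rule ext) (simp add: left_action_def scaleR_add_right scaleR_eq_scaleC[where 'a = 'a] scaleC_scaleC scaleR_conv_of_real
        scaleC_mult_left scaleC_add_right)
  show "norm (u + v) \<le> norm u + norm v"
    using norm_triangle_ineq[of "scalar_part u" "scalar_part v"]
      onorm_triangle[OF bounded_linear_left_action[of u] bounded_linear_left_action[of v]]
    unfolding norm_unitization_def act_add parts_simps max_def by (simp split: if_split)
  show "norm (r *\<^sub>R u) = \<bar>r\<bar> * norm u"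
    by (simp add: norm_unitization_def act_scale onorm_scaleR[OF bounded_linear_left_action]
        max_mult_distrib_left)
  show "norm u = 0 \<longleftrightarrow> u = 0"
  proof
    assume "norm u = 0"
    then have "scalar_part u = 0" "onorm (left_action u) = 0"
      using onorm_pos_le[OF bounded_linear_left_action[of u]]
      by (auto simp: norm_unitization_def max_def split: if_splits)
    moreover from this have "norm (alg_part u * x) \<le> 0 * norm x" for x
      using onorm[OF bounded_linear_left_action, of u x] by (simp add: left_action_def)
    then have "norm (alg_part u) \<le> 0" by (rule norm_le_if_mult_le) simp
    ultimately show "u = 0" by (simp add: unitization_eqI)
  next
    assume "u = 0"
    moreover have "left_action (0 :: 'a unitization) = (\<lambda>x. 0)"
      by (rule ext) (simp add: left_action_def)
    ultimately show "norm u = 0" by (simp add: norm_unitization_def onorm_zero)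
  qed
qed (simp_all add: dist_unitization_def sgn_unitization_def uniformity_unitization_def
      open_unitization_def)

end

lemma norm_left_action_le: "norm (left_action u x) \<le> norm u * norm x"
  by (rule order_trans[OF onorm[OF bounded_linear_left_action]])
    (simp add: norm_unitization_def mult_right_mono)

lemma norm_scalar_part_le: "cmod (scalar_part u) \<le> norm u"
  by (simp add: norm_unitization_def)

lemma norm_unitization_le:
  "cmod (scalar_part u) \<le> c \<Longrightarrow> (\<And>x. norm (left_action u x) \<le> c * norm x) \<Longrightarrow> norm u \<le> c"
  unfolding norm_unitization_def by (intro max.boundedI onorm_bound) (auto intro: order_trans[OF norm_ge_zero])

lemma norm_alg_part_le: "norm (alg_part u) \<le> 2 * norm u"
proof (rule norm_le_if_mult_le)
  fix x
  have "alg_part u * x = left_action u x - scaleC (scalar_part u) x" by (simp add: left_action_def)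
  then have "norm (alg_part u * x) \<le> norm u * norm x + cmod (scalar_part u) * norm x"
    using norm_triangle_ineq4[of "left_action u x" "scaleC (scalar_part u) x"]
      norm_left_action_le[of u x]
    by (simp add: norm_scaleC)
  also have "\<dots> \<le> 2 * norm u * norm x"
    using mult_right_mono[OF norm_scalar_part_le[of u] norm_ge_zero[of x]] by (simp add: mult.commute)
  finally show "norm (alg_part u * x) \<le> 2 * norm u * norm x" .
qed simp

lemma norm_unitization_le_add: "norm u \<le> norm (alg_part u) + cmod (scalar_part u)"
proof (rule norm_unitization_le)
  show "norm (left_action u x) \<le> (norm (alg_part u) + cmod (scalar_part u)) * norm x" for x
    using norm_triangle_ineq[of "alg_part u * x" "scaleC (scalar_part u) x"]
      norm_mult_ineq[of "alg_part u" x]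
    by (simp add: left_action_def norm_scaleC distrib_right)
qed simp

lemma norm_Unitize_zero [simp]: "norm (Unitize a 0) = norm a"
proof (rule antisym)
  show "norm (Unitize a 0) \<le> norm a" using norm_unitization_le_add[of "Unitize a 0"] by simp
  show "norm a \<le> norm (Unitize a 0)"
  proof (rule norm_le_if_mult_le)
    show "norm (a * x) \<le> norm (Unitize a 0) * norm x" for x
      using norm_left_action_le[of "Unitize a 0" x] by (simp add: left_action_def)
  qed simp
qed

instance unitization :: (cstar_algebra) banach
proof
  fix X :: "nat \<Rightarrow> 'a unitization"
  assume X: "Cauchy X"
  have "bounded_linear (alg_part :: 'a unitization \<Rightarrow> 'a)"
    by (rule bounded_linear_intro[where K = 2]) (simp_all, metis norm_alg_part_le mult.commute)
  from bounded_linear.Cauchy[OF this X] obtain a where a: "(\<lambda>n. alg_part (X n)) \<longlonglongrightarrow> a"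
    by (auto simp: Cauchy_convergent_iff convergent_def)
  have "bounded_linear (scalar_part :: 'a unitization \<Rightarrow> complex)"
    by (rule bounded_linear_intro[where K = 1]) (simp_all add: norm_scalar_part_le)
  from bounded_linear.Cauchy[OF this X] obtain l where l: "(\<lambda>n. scalar_part (X n)) \<longlonglongrightarrow> l"
    by (auto simp: Cauchy_convergent_iff convergent_def)
  have "(\<lambda>n. norm (alg_part (X n) - a) + cmod (scalar_part (X n) - l)) \<longlonglongrightarrow> 0"
    using a l by (auto intro: tendsto_add_zero simp: tendsto_norm_zero_iff LIM_zero_iff)
  then have "(\<lambda>n. X n - Unitize a l) \<longlonglongrightarrow> 0"
  proof (rule Lim_null_comparison[rotated])
    show "\<forall>\<^sub>F n in sequentially. norm (X n - Unitize a l)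
        \<le> norm (alg_part (X n) - a) + cmod (scalar_part (X n) - l)"
      using norm_unitization_le_add[of "X n - Unitize a l" for n] by simp
  qed
  then show "convergent X" by (auto simp: LIM_zero_iff convergent_def)
qed

instantiation unitization :: (cstar_algebra) unital_cstar_algebra
begin

definition "1 = Unitize 0 1"
definition "u * v = Unitize
  (alg_part u * alg_part v + scaleC (scalar_part v) (alg_part u) + scaleC (scalar_part u) (alg_part v))
  (scalar_part u * scalar_part v)"
definition "scaleC c u = Unitize (scaleC c (alg_part u)) (c * scalar_part u)"
definition "adj u = Unitize (adj (alg_part u)) (cnj (scalar_part u))"

lemmas unitization_ops =
  one_unitization_def times_unitization_def scaleC_unitization_def adj_unitization_def

lemma left_action_mult: "left_action (u * v) x = left_action u (left_action v x)"
  by (simp add: left_action_def unitization_ops algebra_simps scaleC_add_right scaleC_mult_left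
      scaleC_mult_right scaleC_scaleC mult.commute)

lemma mult_left_action_adj: "adj y * left_action (adj u) x = adj (left_action u y) * x"
  by (simp add: left_action_def unitization_ops adj_add adj_mult adj_scaleC algebra_simps
      scaleC_mult_left scaleC_mult_right)

lemma left_action_scaleC: "left_action (scaleC c u) x = scaleC c (left_action u x)"
  by (simp add: left_action_def unitization_ops scaleC_add_right scaleC_mult_left scaleC_scaleC)

instance
proof
  fix u v w :: "'a unitization" and c d :: complex and r :: real
  show "u * v * w = u * (v * w)"
    by (simp add: unitization_ops algebra_simps scaleC_add_right scaleC_mult_left scaleC_mult_right
        scaleC_scaleC mult.commute)
  show "(u + v) * w = u * w + v * w" "u * (v + w) = u * v + u * w"
    by (simp_all add: unitization_ops unitization_eqI algebra_simps scaleC_add_right scaleC_add_left)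
  show "r *\<^sub>R u * v = r *\<^sub>R (u * v)" "u * r *\<^sub>R v = r *\<^sub>R (u * v)"
    by (simp_all add: unitization_ops unitization_eqI scaleR_eq_scaleC scaleC_mult_left
        scaleC_mult_right scaleC_scaleC scaleC_add_right mult.commute mult.left_commute scaleR_conv_of_real)
  show "1 * u = u" "u * 1 = u" by (simp_all add: unitization_ops unitization_eqI)
  show "(0 :: 'a unitization) \<noteq> 1" by (simp add: unitization_ops zero_unitization_def)
  show submult: "norm (u * v) \<le> norm u * norm v" for u v :: "'a unitization"
  proof (rule norm_unitization_le)
    show "cmod (scalar_part (u * v)) \<le> norm u * norm v"
      by (simp add: unitization_ops norm_mult mult_mono norm_scalar_part_le)
    show "norm (left_action (u * v) x) \<le> norm u * norm v * norm x" for x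
      unfolding left_action_mult
      by (rule order_trans[OF norm_left_action_le])
        (simp add: mult.assoc mult_left_mono norm_left_action_le)
  qed
  show "norm (1 :: 'a unitization) = 1"
  proof (rule antisym)
    show "norm (1 :: 'a unitization) \<le> 1"
      by (rule norm_unitization_le) (simp_all add: unitization_ops left_action_def)
    show "1 \<le> norm (1 :: 'a unitization)"
      using norm_scalar_part_le[of "1 :: 'a unitization"] by (simp add: unitization_ops)
  qed
  show "scaleC c (u + v) = scaleC c u + scaleC c v" "scaleC (c + d) u = scaleC c u + scaleC d u"
    "scaleC c (scaleC d u) = scaleC (c * d) u" "scaleC (complex_of_real r) u = r *\<^sub>R u"
    by (simp_all add: unitization_ops unitization_eqI scaleC_add_right scaleC_add_left scaleC_scaleC
        algebra_simps scaleC_of_real scaleR_conv_of_real)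
  have norm_scaleC_le: "norm (scaleC c u) \<le> cmod c * norm u" for c and u :: "'a unitization"
  proof (rule norm_unitization_le)
    show "cmod (scalar_part (scaleC c u)) \<le> cmod c * norm u"
      by (simp add: unitization_ops norm_mult mult_left_mono norm_scalar_part_le)
    show "norm (left_action (scaleC c u) x) \<le> cmod c * norm u * norm x" for x
      by (simp add: left_action_scaleC norm_scaleC mult.assoc mult_left_mono norm_left_action_le)
  qed
  show "norm (scaleC c u) = cmod c * norm u"
  proof (cases "c = 0")
    case True
    then show ?thesis using norm_scaleC_le[of c u] by simp
  next
    case False
    have "scaleC (inverse c) (scaleC c u) = u"
      using False by (simp add: unitization_ops scaleC_scaleC flip: mult.assoc)
    then have "norm u \<le> cmod (inverse c) * norm (scaleC c u)"
      using norm_scaleC_le[of "inverse c" "scaleC c u"] by (simp only:)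
    then have "cmod c * norm u \<le> norm (scaleC c u)"
      using False unfolding norm_inverse by (simp add: field_simps)
    then show ?thesis using norm_scaleC_le[of c u] by simp
  qed
  show "scaleC c u * v = scaleC c (u * v)"
    by (simp add: unitization_ops scaleC_mult_left scaleC_add_right scaleC_scaleC mult.commute)
  show "u * scaleC c v = scaleC c (u * v)"
    by (simp add: unitization_ops scaleC_mult_right scaleC_add_right scaleC_scaleC mult.left_commute)
      (simp add: mult.commute)
  show "adj (u + v) = adj u + adj v" "adj (scaleC c u) = scaleC (cnj c) (adj u)"
    by (simp_all add: unitization_ops plus_unitization_def adj_add adj_scaleC)
  show "adj (u * v) = adj v * adj u"
    by (simp add: unitization_ops adj_add adj_scaleC adj_mult mult.commute add.assoc)
  show adj_adj_u: "adj (adj u) = u" for u :: "'a unitization"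
    by (simp add: unitization_ops adj_adj)
  have square_le: "(norm u)\<^sup>2 \<le> norm (adj u * u)" for u :: "'a unitization"
  proof -
    define c where "c = norm (adj u * u)"
    have "norm u \<le> sqrt c"
    proof (rule norm_unitization_le)
      have "(cmod (scalar_part u))\<^sup>2 \<le> c"
        using norm_scalar_part_le[of "adj u * u"]
        by (simp add: c_def unitization_ops norm_mult power2_eq_square)
      then show "cmod (scalar_part u) \<le> sqrt c" by (rule real_le_rsqrt)
      fix x
      have "(norm (left_action u x))\<^sup>2 = norm (adj x * left_action (adj u * u) x)"
        by (simp add: left_action_mult mult_left_action_adj flip: cstar_identity)
      also have "\<dots> \<le> norm x * (c * norm x)"
        unfolding c_def
        by (rule order_trans[OF norm_mult_ineq]) (simp add: mult_left_mono norm_left_action_le)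
      also have "\<dots> = (sqrt c * norm x)\<^sup>2"
        by (simp add: c_def power_mult_distrib) (simp add: power2_eq_square)
      finally show "norm (left_action u x) \<le> sqrt c * norm x"
        by (rule power2_le_imp_le) (simp add: c_def)
    qed
    then have "(norm u)\<^sup>2 \<le> (sqrt c)\<^sup>2" by (rule power_mono) simp
    then show ?thesis by (simp add: c_def)
  qed
  have le_adj: "norm u \<le> norm (adj u)" for u :: "'a unitization"
  proof (cases "norm u = 0")
    case False
    have "norm u * norm u \<le> norm (adj u) * norm u"
      using order_trans[OF square_le submult] by (simp add: power2_eq_square)
    then show ?thesis using False by simp
  qed simp
  have "norm (adj u * u) \<le> norm u * norm u"
    using submult[of "adj u" u] le_adj[of "adj u"] by (simp add: adj_adj_u) (meson mult_right_mono norm_ge_zero order_trans)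
  then show "norm (adj u * u) = (norm u)\<^sup>2"
    using square_le[of u] by (simp add: power2_eq_square)
qed

end

section \<open>Norming states\<close>

definition sublinear :: "('v::real_vector \<Rightarrow> real) \<Rightarrow> bool" where
  "sublinear p \<longleftrightarrow> (\<forall>x y. p (x + y) \<le> p x + p y) \<and> (\<forall>r\<ge>0. \<forall>x. p (r *\<^sub>R x) = r * p x)"

lemma sublinear_add: "sublinear p \<Longrightarrow> p (x + y) \<le> p x + p y"
  and sublinear_scale: "sublinear p \<Longrightarrow> 0 \<le> r \<Longrightarrow> p (r *\<^sub>R x) = r * p x"
  by (simp_all add: sublinear_def)

lemma sublinear_zero: "sublinear p \<Longrightarrow> p 0 = 0"
  using sublinear_scale[of p 0 0] by simp

lemma sublinear_ge_uminus: "sublinear p \<Longrightarrow> - p (- x) \<le> p x"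
  using sublinear_add[of p x "-x"] sublinear_zero[of p] by simp

text \<open>The functional \<open>q x = inf {p (x + t y) - t p y | t \<ge> 0}\<close> is the standard modification of \<open>p\<close> that
  is forced to be linear along \<open>y\<close>.\<close>

lemma sublinear_descend:
  fixes p :: "'v::real_vector \<Rightarrow> real"
  assumes p: "sublinear p"
  obtains q where "sublinear q" "q \<le> p" "q (- y) \<le> - p y"
proof -
  define S where "S x = (\<lambda>t. p (x + t *\<^sub>R y) - t * p y) ` {0..}" for x
  define q where "q x = Inf (S x)" for x
  have lower: "- p (- x) \<le> s" if s: "s \<in> S x" for s x
  proof -
    obtain t where t: "0 \<le> t" "s = p (x + t *\<^sub>R y) - t * p y" using s by (auto simp: S_def)
    have "t * p y = p ((x + t *\<^sub>R y) + (- x))" using sublinear_scale[OF p t(1)] by simp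
    also have "\<dots> \<le> p (x + t *\<^sub>R y) + p (- x)" by (rule sublinear_add[OF p])
    finally show ?thesis using t(2) by simp
  qed
  have bdd: "bdd_below (S x)" for x using lower by (auto simp: bdd_below_def)
  have q_le: "q x \<le> p (x + t *\<^sub>R y) - t * p y" if "0 \<le> t" for x t
    unfolding q_def by (rule cInf_lower[OF _ bdd]) (use that in \<open>auto simp: S_def\<close>)
  have q_ge: "c \<le> q x" if "\<And>t. 0 \<le> t \<Longrightarrow> c \<le> p (x + t *\<^sub>R y) - t * p y" for c x
    unfolding q_def by (rule cInf_greatest) (use that in \<open>auto simp: S_def\<close>)
  have add: "q (x + z) \<le> q x + q z" for x z
  proof -
    have "q (x + z) - (p (z + t *\<^sub>R y) - t * p y) \<le> q x" if t: "0 \<le> t" for t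
    proof (rule q_ge)
      fix s :: real assume s: "0 \<le> s"
      have "q (x + z) \<le> p ((x + s *\<^sub>R y) + (z + t *\<^sub>R y)) - (s + t) * p y"
        using q_le[of "s + t" "x + z"] s t by (simp add: algebra_simps)
      also have "\<dots> \<le> (p (x + s *\<^sub>R y) + p (z + t *\<^sub>R y)) - (s + t) * p y"
        using sublinear_add[OF p, of "x + s *\<^sub>R y" "z + t *\<^sub>R y"] by (rule diff_right_mono)
      finally show "q (x + z) - (p (z + t *\<^sub>R y) - t * p y) \<le> p (x + s *\<^sub>R y) - s * p y"
        by (simp add: algebra_simps)
    qed
    then have "q (x + z) - q x \<le> p (z + t *\<^sub>R y) - t * p y" if "0 \<le> t" for t
      using that by (simp add: algebra_simps)
    then have "q (x + z) - q x \<le> q z" by (rule q_ge)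
    then show ?thesis by simp
  qed
  have q_zero: "q 0 = 0"
  proof (rule antisym)
    show "q 0 \<le> 0" using q_le[of 0 0] sublinear_zero[OF p] by simp
    show "0 \<le> q 0" by (rule q_ge) (simp add: sublinear_scale[OF p])
  qed
  have scale_le: "q (r *\<^sub>R x) \<le> r * q x" if r: "0 < r" for r x
  proof -
    have "q (r *\<^sub>R x) / r \<le> q x"
    proof (rule q_ge)
      fix t :: real assume t: "0 \<le> t"
      have "q (r *\<^sub>R x) \<le> p (r *\<^sub>R (x + t *\<^sub>R y)) - (r * t) * p y"
        using q_le[of "r * t" "r *\<^sub>R x"] r t by (simp add: scaleR_add_right)
      also have "\<dots> = (p (x + t *\<^sub>R y) - t * p y) * r"
        using sublinear_scale[OF p, of r "x + t *\<^sub>R y"] r by (simp add: algebra_simps)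
      finally show "q (r *\<^sub>R x) / r \<le> p (x + t *\<^sub>R y) - t * p y"
        by (simp only: pos_divide_le_eq[OF r])
    qed
    then show ?thesis using r by (simp add: pos_divide_le_eq mult.commute)
  qed
  have scale: "q (r *\<^sub>R x) = r * q x" if "0 \<le> r" for r x
  proof (cases "r = 0")
    case False
    with that have r: "0 < r" by simp
    have "q x \<le> q (r *\<^sub>R x) / r"
      using scale_le[of "inverse r" "r *\<^sub>R x"] r by (simp add: divide_inverse mult.commute)
    then have "r * q x \<le> q (r *\<^sub>R x)" by (simp only: pos_le_divide_eq[OF r] mult.commute)
    with scale_le[OF r, of x] show ?thesis by (rule antisym)
  qed (simp add: q_zero)
  show ?thesis
  proof
    show "sublinear q" using add scale by (simp add: sublinear_def)
    show "q \<le> p" using q_le[of 0] by (auto simp: le_fun_def)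
    show "q (- y) \<le> - p y" using q_le[of 1 "- y"] sublinear_zero[OF p] by simp
  qed
qed

text \<open>Zorn's lemma: the pointwise infimum of a chain of sublinear functionals below \<open>p\<close> is sublinear, and
  it is finite because \<open>- p (- x)\<close> is a lower bound for each of them at \<open>x\<close>.\<close>

lemma minimal_sublinear_exists:
  fixes p :: "'v::real_vector \<Rightarrow> real"
  assumes p: "sublinear p"
  obtains f where "sublinear f" "f \<le> p" "\<And>q. sublinear q \<Longrightarrow> q \<le> f \<Longrightarrow> q = f"
proof -
  define A where "A = {q. sublinear q \<and> q \<le> p}"
  have "\<exists>m\<in>A. \<forall>a\<in>A. a \<le> m \<longrightarrow> a = m"
  proof (rule predicate_Zorn[where P = "(\<ge>)", simplified])
    show "partial_order_on A (relation_of (\<ge>) A)"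
      by (rule partial_order_on_relation_ofI) auto
  next
    fix C assume C: "C \<in> Chains (relation_of (\<ge>) A)"
    then have CA: "C \<subseteq> A" using Chains_relation_of by blast
    have chain: "q \<le> q' \<or> q' \<le> q" if "q \<in> C" "q' \<in> C" for q q'
      using C that by (auto simp: Chains_def relation_of_def)
    show "\<exists>u\<in>A. \<forall>a\<in>C. u \<le> a"
    proof (cases "C = {}")
      case True
      then show ?thesis using p by (auto simp: A_def)
    next
      case False
      define u where "u x = (INF q\<in>C. q x)" for x
      have lower: "- p (- x) \<le> q x" if "q \<in> C" for q x
      proof -
        have "sublinear q" "q (- x) \<le> p (- x)" using that CA by (auto simp: A_def le_fun_def)
        then show ?thesis using sublinear_ge_uminus[of q x] by simp
      qed
      then have bdd: "bdd_below ((\<lambda>q. q x) ` C)" for x by (auto simp: bdd_below_def)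
      have u_le: "u x \<le> q x" if "q \<in> C" for q x
        unfolding u_def by (rule cINF_lower[OF bdd that])
      have u_ge: "c \<le> u x" if "\<And>q. q \<in> C \<Longrightarrow> c \<le> q x" for c x
        unfolding u_def by (rule cINF_greatest[OF False that])
      have subC: "sublinear q" if "q \<in> C" for q using that CA by (auto simp: A_def)
      have "u (x + y) \<le> u x + u y" for x y
      proof -
        have "u (x + y) - q' y \<le> u x" if q': "q' \<in> C" for q'
        proof (rule u_ge)
          fix q assume q: "q \<in> C"
          obtain m where m: "m \<in> C" "m \<le> q" "m \<le> q'" using chain[OF q q'] q q' by auto
          have "u (x + y) \<le> m x + m y"
            using u_le[OF m(1)] sublinear_add[OF subC[OF m(1)]] order_trans by blast
          also have "\<dots> \<le> q x + q' y" using m by (simp add: le_fun_def add_mono)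
          finally show "u (x + y) - q' y \<le> q x" by simp
        qed
        then have "u (x + y) - u x \<le> q y" if "q \<in> C" for q
          using that by (simp add: algebra_simps)
        then have "u (x + y) - u x \<le> u y" by (rule u_ge)
        then show ?thesis by simp
      qed
      moreover have "u (r *\<^sub>R x) = r * u x" if r: "0 \<le> r" for r x
      proof (cases "r = 0")
        case True
        have "u 0 = 0" unfolding u_def using False by (simp add: sublinear_zero subC)
        then show ?thesis using True by simp
      next
        case False
        then have r': "0 < r" using r by simp
        show ?thesis
        proof (rule antisym)
          have "u (r *\<^sub>R x) / r \<le> u x"
            by (rule u_ge) (use u_le[of _ "r *\<^sub>R x"] r' in \<open>simp add: sublinear_scale subC divide_le_eq mult.commute\<close>)
          then show "u (r *\<^sub>R x) \<le> r * u x" using r' by (simp add: field_simps)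
          show "r * u x \<le> u (r *\<^sub>R x)"
            by (rule u_ge) (use u_le r' in \<open>simp add: sublinear_scale subC\<close>)
        qed
      qed
      moreover have "u \<le> p"
      proof -
        obtain q where q: "q \<in> C" using False by blast
        then have "q \<le> p" using CA by (auto simp: A_def)
        then show ?thesis using u_le[OF q] by (meson le_funD le_funI order_trans)
      qed
      ultimately have "u \<in> A" by (simp add: A_def sublinear_def)
      then show ?thesis using u_le by (auto simp: le_fun_def)
    qed
  qed
  then obtain f where f: "f \<in> A" "\<And>a. a \<in> A \<Longrightarrow> a \<le> f \<Longrightarrow> a = f" by auto
  show ?thesis
  proof
    show "sublinear f" "f \<le> p" using f(1) by (auto simp: A_def)
    show "q = f" if "sublinear q" "q \<le> f" for q
      using that f by (auto simp: A_def intro: order_trans)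
  qed
qed

text \<open>The analytic Hahn-Banach theorem. A minimal sublinear functional cannot be lowered along any
  direction, so it is odd and hence linear; descending along \<open>y\<close> before minimizing fixes the value
  at \<open>y\<close>.\<close>

lemma linear_minorant_exists:
  fixes p :: "'v::real_vector \<Rightarrow> real"
  assumes p: "sublinear p"
  obtains f where "linear f" "f \<le> p" "f y = p y"
proof -
  obtain p' where p': "sublinear p'" "p' \<le> p" "p' (- y) \<le> - p y"
    using p by (rule sublinear_descend)
  obtain f where f: "sublinear f" "f \<le> p'" and min: "\<And>q. sublinear q \<Longrightarrow> q \<le> f \<Longrightarrow> q = f"
    using p'(1) by (rule minimal_sublinear_exists) blast
  have odd: "f (- x) = - f x" for x
  proof (rule antisym)
    obtain q where "sublinear q" "q \<le> f" "q (- x) \<le> - f x" using f(1) by (rule sublinear_descend)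
    then show "f (- x) \<le> - f x" using min[of q] by simp
    show "- f x \<le> f (- x)" using sublinear_ge_uminus[OF f(1), of "-x"] by simp
  qed
  show ?thesis
  proof
    show "linear f"
    proof (rule linearI)
      show "f (x + z) = f x + f z" for x z
        using sublinear_add[OF f(1), of x z] sublinear_add[OF f(1), of "-x" "-z"] odd[of "x + z"]
        by (simp add: odd)
      show "f (r *\<^sub>R x) = r *\<^sub>R f x" for r x
      proof (cases "0 \<le> r")
        case False
        then have "f (- ((- r) *\<^sub>R x)) = - ((- r) * f x)"
          unfolding odd using sublinear_scale[OF f(1), of "- r" x] by simp
        then show ?thesis by simp
      qed (simp add: sublinear_scale[OF f(1)])
    qed
    show "f \<le> p" using f(2) p'(2) by (rule order_trans)
    then have "f y \<le> p y" by (simp add: le_fun_def)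
    moreover have "f (- y) \<le> - p y" using le_funD[OF f(2), of "- y"] p'(3) by simp
    ultimately show "f y = p y" by (simp add: odd)
  qed
qed

definition nonneg :: "'a::cstar_algebra \<Rightarrow> bool" where
  "nonneg a \<longleftrightarrow> norm_positive (Unitize a 0)"

lemma Unitize_add: "Unitize (a + b) 0 = Unitize a 0 + Unitize b 0"
  by (simp add: unitization_eqI)

lemma nonneg_adj_mult_self: "nonneg (adj b * b)"
proof -
  have "Unitize (adj b * b) 0 = adj (Unitize b 0) * Unitize b 0"
    by (simp add: unitization_ops)
  then show ?thesis by (simp add: nonneg_def norm_positive_adj_mult_self)
qed

lemma nonneg_add: "nonneg a \<Longrightarrow> nonneg b \<Longrightarrow> nonneg (a + b)"
  by (simp add: nonneg_def Unitize_add norm_positive_add)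

lemma nonneg_scaleR: "nonneg a \<Longrightarrow> 0 \<le> r \<Longrightarrow> nonneg (r *\<^sub>R a)"
  using norm_positive_scaleR[of "Unitize a 0" r] by (simp add: nonneg_def scaleR_unitization_def)

lemma nonneg_zero: "nonneg 0"
  using nonneg_adj_mult_self[of 0] by simp

lemma norm_mono_nonneg: "nonneg a \<Longrightarrow> nonneg s \<Longrightarrow> norm a \<le> norm (a + s)"
  using norm_mono_norm_positive[of "Unitize a 0" "Unitize s 0"]
  by (simp add: nonneg_def flip: Unitize_add)

text \<open>The functional minorizes the distance \<open>p x = inf {\<parallel>x + s\<parallel> | s \<ge> 0}\<close> and attains it at \<open>a\<close>. It is
  nonnegative on the cone since \<open>p (- s) \<le> 0\<close> for \<open>s\<close> in the cone, and \<open>p a = \<parallel>a\<parallel>\<close> by monotonicity of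
  the norm.\<close>

lemma norming_real_functional:
  fixes a :: "'a::cstar_algebra"
  assumes a: "nonneg a"
  obtains f where "linear f" "\<And>x. f x \<le> norm x" "\<And>s. nonneg s \<Longrightarrow> 0 \<le> f s" "norm a \<le> f a"
proof -
  define D where "D x = (\<lambda>s. norm (x + s)) ` {s. nonneg s}" for x :: 'a
  define p where "p x = Inf (D x)" for x
  have bdd: "bdd_below (D x)" for x by (auto simp: D_def bdd_below_def intro: exI[of _ 0])
  have p_le: "p x \<le> norm (x + s)" if "nonneg s" for x s
    unfolding p_def by (rule cInf_lower[OF _ bdd]) (use that in \<open>auto simp: D_def\<close>)
  have p_ge: "c \<le> p x" if "\<And>s. nonneg s \<Longrightarrow> c \<le> norm (x + s)" for c x
    unfolding p_def by (rule cInf_greatest) (use that nonneg_zero in \<open>auto simp: D_def\<close>)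
  have add: "p (x + y) \<le> p x + p y" for x y
  proof -
    have "p (x + y) - norm (y + t) \<le> p x" if t: "nonneg t" for t
    proof (rule p_ge)
      fix s :: 'a assume s: "nonneg s"
      have "p (x + y) \<le> norm ((x + s) + (y + t))"
        using p_le[OF nonneg_add[OF s t], of "x + y"] by (simp add: algebra_simps)
      also have "\<dots> \<le> norm (x + s) + norm (y + t)" by (rule norm_triangle_ineq)
      finally show "p (x + y) - norm (y + t) \<le> norm (x + s)" by simp
    qed
    then have "p (x + y) - p x \<le> norm (y + t)" if "nonneg t" for t
      using that by (simp add: algebra_simps)
    then have "p (x + y) - p x \<le> p y" by (rule p_ge)
    then show ?thesis by simp
  qed
  have scale_le: "p (r *\<^sub>R x) \<le> r * p x" if r: "0 < r" for r x
  proof -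
    have "p (r *\<^sub>R x) / r \<le> p x"
    proof (rule p_ge)
      fix s :: 'a assume s: "nonneg s"
      have "p (r *\<^sub>R x) \<le> norm (r *\<^sub>R (x + s))"
        using p_le[OF nonneg_scaleR[OF s], of r "r *\<^sub>R x"] r by (simp add: scaleR_add_right)
      also have "\<dots> = norm (x + s) * r" using r by simp
      finally show "p (r *\<^sub>R x) / r \<le> norm (x + s)" by (simp only: pos_divide_le_eq[OF r])
    qed
    then show ?thesis using r by (simp add: pos_divide_le_eq mult.commute)
  qed
  have scale: "p (r *\<^sub>R x) = r * p x" if "0 \<le> r" for r x
  proof (cases "r = 0")
    case True
    have "p 0 = 0"
      using p_le[OF nonneg_zero, of 0] by (intro antisym p_ge) simp_all
    then show ?thesis using True by simp
  next
    case False
    with that have r: "0 < r" by simp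
    have "p x \<le> p (r *\<^sub>R x) / r"
      using scale_le[of "inverse r" "r *\<^sub>R x"] r by (simp add: divide_inverse mult.commute)
    then have "r * p x \<le> p (r *\<^sub>R x)" by (simp only: pos_le_divide_eq[OF r] mult.commute)
    with scale_le[OF r, of x] show ?thesis by (rule antisym)
  qed
  have "sublinear p" using add scale by (simp add: sublinear_def)
  then obtain f where f: "linear f" "f \<le> p" "f a = p a" by (rule linear_minorant_exists)
  show ?thesis
  proof
    show "linear f" by (rule f)
    show "f x \<le> norm x" for x
      using le_funD[OF f(2), of x] p_le[OF nonneg_zero, of x] by simp
    show "0 \<le> f s" if "nonneg s" for s
    proof -
      have "f (- s) \<le> p (- s)" using f(2) by (simp add: le_fun_def)
      also have "\<dots> \<le> 0" using p_le[OF that, of "- s"] by simp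
      finally show ?thesis by (simp add: linear_neg[OF f(1)])
    qed
    show "norm a \<le> f a" unfolding f(3) by (rule p_ge) (rule norm_mono_nonneg[OF a])
  qed
qed

text \<open>The real functional is made invariant under the adjoint and then complexified. The norm is
  unchanged, as usual, by rotating a value onto the positive real axis.\<close>

lemma norming_state:
  fixes a :: "'a::cstar_algebra"
  assumes a: "positive a" and nz: "a \<noteq> 0"
  obtains f where "state f" "f a = complex_of_real (norm a)"
proof -
  have pos: "nonneg s" if "positive s" for s :: 'a
    using that nonneg_adj_mult_self by (auto simp: positive_def)
  have pos_adj: "adj s = s" if "positive s" for s :: 'a
    using that by (auto simp: positive_def adj_mult adj_adj)
  obtain f where f: "linear f" and f_le: "\<And>x. f x \<le> norm x"
    and f_pos: "\<And>s. nonneg s \<Longrightarrow> 0 \<le> f s" and f_a: "norm a \<le> f a"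
    using norming_real_functional[OF pos[OF a]] by blast
  define g where "g x = (f x + f (adj x)) / 2" for x
  define F where "F x = Complex (g x) (- g (scaleC \<i> x))" for x
  have g_add: "g (x + y) = g x + g y" for x y
    by (simp add: g_def adj_add linear_add[OF f] add_divide_distrib)
  have g_scale: "g (r *\<^sub>R x) = r * g x" for r x
    by (simp add: g_def adj_scaleR linear_scale[OF f] distrib_left)
  have g_minus: "g (- x) = - g x" for x
    using g_scale[of "-1" x] by simp
  have g_le: "g x \<le> norm x" for x
    using f_le[of x] f_le[of "adj x"] by (simp add: g_def)
  have g_pos: "g s = f s" "g (scaleC \<i> s) = 0" if "positive s" for s
    using pos_adj[OF that]
    by (simp_all add: g_def adj_scaleC scaleC_minus_left linear_neg[OF f])
  have F_add: "F (x + y) = F x + F y" for x y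
    by (simp add: F_def g_add scaleC_add_right complex_eq_iff)
  have F_scale: "F (scaleC c x) = c * F x" for c x
  proof -
    have "scaleC c x = Re c *\<^sub>R x + Im c *\<^sub>R scaleC \<i> x"
      unfolding scaleR_eq_scaleC scaleC_scaleC scaleC_add_left[symmetric]
      by (rule arg_cong[where f = "\<lambda>c. scaleC c x"]) (simp add: complex_eq_iff)
    moreover have "scaleC \<i> (scaleC c x) = Re c *\<^sub>R scaleC \<i> x + Im c *\<^sub>R (- x)"
      unfolding scaleR_eq_scaleC scaleC_scaleC scaleC_minus_right scaleC_minus_left[symmetric]
        scaleC_add_left[symmetric]
      by (rule arg_cong[where f = "\<lambda>c. scaleC c x"]) (simp add: complex_eq_iff)
    ultimately show ?thesis
      by (simp only: F_def g_add g_scale g_minus) (simp add: complex_eq_iff)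
  qed
  have F_norm: "cmod (F x) \<le> norm x" for x
  proof (cases "F x = 0")
    case False
    \<comment> \<open>the phase that rotates \<open>F x\<close> onto the positive real axis\<close>
    define c where "c = cnj (F x) / cmod (F x)"
    have "F (scaleC c x) = complex_of_real (cmod (F x))"
      using complex_norm_square[of "F x"] False
      by (simp add: F_scale c_def power2_eq_square mult.commute divide_eq_eq)
    then have "cmod (F x) = g (scaleC c x)" by (simp add: F_def complex_eq_iff)
    also have "\<dots> \<le> norm (scaleC c x)" by (rule g_le)
    also have "\<dots> = norm x" using False by (simp add: norm_scaleC c_def norm_divide)
    finally show ?thesis .
  qed simp
  have F_bl: "bounded_linear F"
    by (rule bounded_linear_intro[where K = 1])
       (simp_all add: F_add F_norm scaleR_eq_scaleC[where 'a = 'a] F_scale scaleR_conv_of_real)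
  have "f a = norm a" using f_a f_le[of a] by simp
  then have Fa: "F a = complex_of_real (norm a)"
    by (simp add: F_def g_pos[OF a] complex_eq_iff)
  have "onorm F = 1"
  proof (rule antisym)
    show "onorm F \<le> 1" by (rule onorm_bound) (simp_all add: F_norm)
    have "norm (F a) \<le> onorm F * norm a" by (rule onorm[OF F_bl])
    then show "1 \<le> onorm F" using nz by (simp add: Fa)
  qed
  moreover have "positive_functional F"
    unfolding positive_functional_def
    using F_add F_scale f_pos[OF pos] by (simp add: F_def g_pos)
  ultimately show ?thesis using that[of F] F_bl Fa by (simp add: state_def)
qed

section \<open>Hilbert modules\<close>

context hilbert_module
begin

lemma ip_add_left: "ip (x + y) z = ip x z + ip y z"
  unfolding ip_adj[of "x + y" z] ip_adj[of x z] ip_adj[of y z] by (simp only: ip_add_right adj_add)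

lemma ip_scaleC_left: "ip (scaleC c x) y = scaleC (cnj c) (ip x y)"
  unfolding ip_adj[of "scaleC c x" y] ip_adj[of x y] by (simp only: ip_scaleC_right adj_scaleC)

lemma ip_zero_right [simp]: "ip x 0 = 0"
  using ip_add_right[of x 0 0] by simp

lemma ip_zero_left [simp]: "ip 0 x = 0"
  using ip_add_left[of 0 0 x] by simp

lemma ip_minus_right: "ip x (- y) = - ip x y"
  using ip_add_right[of x y "- y"] by (simp add: eq_neg_iff_add_eq_0 add.commute)

lemma ip_minus_left: "ip (- x) y = - ip x y"
  using ip_add_left[of x "- x" y] by (simp add: eq_neg_iff_add_eq_0 add.commute)

lemma ip_diff_right: "ip x (y - z) = ip x y - ip x z"
  using ip_add_right[of x y "- z"] by (simp add: ip_minus_right)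

lemma ip_diff_left: "ip (x - y) z = ip x z - ip y z"
  using ip_add_left[of x "- y" z] by (simp add: ip_minus_left)

lemma ip_eq_zero_commute: "ip x y = 0 \<Longrightarrow> ip y x = 0"
  using ip_adj[of y x] by simp

lemma norm_ip_self: "norm (ip x x) = (norm x)\<^sup>2"
  by (simp add: norm_ip)

text \<open>By polarization. The sharp Cauchy-Schwarz inequality for modules would need the order of the
  algebra; continuity of the inner product needs only some bound.\<close>

lemma norm_ip_le_square_sum: "norm (ip x y) \<le> (norm x + norm y)\<^sup>2"
proof -
  define q where "q z = ip z z" for z
  define S where "S = (norm x + norm y)\<^sup>2"
  have real_part: "q (x + y) - q (x - y) = scaleC 2 (ip x y) + scaleC 2 (ip y x)"
    using scaleC_add_left[of 1 1 "ip x y"] scaleC_add_left[of 1 1 "ip y x"]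
    by (simp add: q_def ip_add_left ip_add_right ip_diff_left ip_diff_right)
  have "q (x + scaleC \<i> y) - q (x - scaleC \<i> y) = scaleC (2 * \<i>) (ip x y) - scaleC (2 * \<i>) (ip y x)"
    using scaleC_add_left[of \<i> \<i> "ip x y"] scaleC_add_left[of \<i> \<i> "ip y x"]
    by (simp add: q_def ip_add_left ip_add_right ip_diff_left ip_diff_right ip_scaleC_left
        ip_scaleC_right scaleC_minus_left scaleC_add_right scaleC_diff_right)
  then have "scaleC (- \<i>) (q (x + scaleC \<i> y) - q (x - scaleC \<i> y))
      = scaleC 2 (ip x y) - scaleC 2 (ip y x)"
    by (simp add: scaleC_diff_right scaleC_scaleC mult.left_commute[of \<i> 2])
  then have "scaleC 4 (ip x y)
      = (q (x + y) - q (x - y)) + scaleC (- \<i>) (q (x + scaleC \<i> y) - q (x - scaleC \<i> y))"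
    using scaleC_add_left[of 2 2 "ip x y"] by (simp add: real_part)
  then have "4 * norm (ip x y)
      = norm ((q (x + y) - q (x - y)) + scaleC (- \<i>) (q (x + scaleC \<i> y) - q (x - scaleC \<i> y)))"
    using norm_scaleC[of 4 "ip x y"] by (simp only:) simp
  also have "\<dots> \<le> norm (q (x + y) - q (x - y)) + norm (q (x + scaleC \<i> y) - q (x - scaleC \<i> y))"
    by (rule order_trans[OF norm_triangle_ineq]) (simp add: norm_scaleC)
  also have "\<dots> \<le> (S + S) + (S + S)"
  proof -
    have plus: "norm (q (x + z)) \<le> S" if "norm z = norm y" for z
      using norm_triangle_ineq[of x z] that by (simp add: S_def q_def norm_ip_self power_mono)
    then have minus: "norm (q (x - z)) \<le> S" if "norm z = norm y" for z
      using plus[of "- z"] that by simp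
    have "norm (q (x + z) - q (x - z)) \<le> S + S" if "norm z = norm y" for z
      using norm_triangle_ineq4[of "q (x + z)" "q (x - z)"] plus[OF that] minus[OF that] by linarith
    then show ?thesis by (intro add_mono) (simp_all add: norm_scaleC)
  qed
  finally show ?thesis by (simp add: S_def)
qed

lemma norm_ip_le: "norm (ip x y) \<le> 4 * norm x * norm y"
proof (cases "x = 0 \<or> y = 0")
  case False
  then have xy: "0 < norm x" "0 < norm y" by auto
  define u where "u = scaleC (complex_of_real (1 / norm x)) x"
  define v where "v = scaleC (complex_of_real (1 / norm y)) y"
  have "norm u = 1" "norm v = 1" using xy by (simp_all add: u_def v_def norm_scaleC norm_divide)
  then have "norm (ip u v) \<le> 4" using norm_ip_le_square_sum[of u v] by simp
  moreover have "norm (ip u v) = norm (ip x y) / (norm x * norm y)"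
    by (simp add: u_def v_def ip_scaleC_left ip_scaleC_right norm_scaleC norm_divide norm_mult)
  ultimately show ?thesis using xy by (simp add: divide_le_eq)
qed auto

lemma closed_submodule_orth: "closed_submodule act (orth ip M)"
proof -
  have "bounded_linear (\<lambda>x. ip x y)" for y
    by (rule bounded_linear_intro[where K = "4 * norm y"])
      (use norm_ip_le in \<open>simp_all add: ip_add_left scaleR_eq_scaleC ip_scaleC_left mult.commute mult.left_commute\<close>)
  then have "closed {x. ip x y = 0}" for y
    by (intro closed_Collect_eq continuous_intros linear_continuous_on)
  then have "closed (\<Inter>y\<in>M. {x. ip x y = 0})" by (intro closed_INT) auto
  moreover have "orth ip M = (\<Inter>y\<in>M. {x. ip x y = 0})" by (auto simp: orth_def)
  moreover have "ip (act x a) y = adj a * ip x y" for x a y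
    by (metis adj_mult ip_act_right ip_adj)
  ultimately show ?thesis
    by (simp add: closed_submodule_def) (simp add: orth_def ip_add_left ip_scaleC_left)
qed

end

section \<open>Localization at a functional\<close>

text \<open>Everything in the localization is pulled back to the module: a point of the completed quotient is
  represented by a sequence in the module that is Cauchy for the seminorm \<open>x \<mapsto> (f \<langle>x, x\<rangle>)\<^sup>1\<^sup>/\<^sup>2\<close>.\<close>

locale localized_module = hilbert_module act ip
  for act :: "'e::complex_banach \<Rightarrow> 'a::cstar_algebra \<Rightarrow> 'e" and ip +
  fixes f :: "'a \<Rightarrow> complex"
  assumes positive_functional: "positive_functional f"
begin

definition form :: "'e \<Rightarrow> 'e \<Rightarrow> complex" where "form x y = f (ip x y)"
definition seminorm :: "'e \<Rightarrow> real" where "seminorm x = sqrt (Re (form x x))"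

lemma functional_add: "f (a + b) = f a + f b"
  and functional_scaleC: "f (scaleC c a) = c * f a"
  using positive_functional by (simp_all add: positive_functional_def)

lemma form_add_right: "form x (y + z) = form x y + form x z"
  and form_add_left: "form (x + y) z = form x z + form y z"
  and form_scaleC_right: "form x (scaleC c y) = c * form x y"
  and form_scaleC_left: "form (scaleC c x) y = cnj c * form x y"
  by (simp_all add: form_def ip_add_left ip_add_right ip_scaleC_left ip_scaleC_right functional_add
      functional_scaleC)

lemma form_diff_right: "form x (y - z) = form x y - form x z"
  using form_add_right[of x "y - z" z] by simp

lemma form_diff_left: "form (x - y) z = form x z - form y z"
  using form_add_left[of "x - y" y z] by simp

lemma form_self: "Im (form x x) = 0" "0 \<le> Re (form x x)"
  using positive_functional ip_positive[of x] by (simp_all add: form_def positive_functional_def)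

lemma form_commute: "form y x = cnj (form x y)"
proof -
  have "Im (form x y) + Im (form y x) = 0"
    using form_self(1)[of "x + y"] form_self(1)[of x] form_self(1)[of y]
    by (simp add: form_add_left form_add_right)
  moreover have "Re (form x y) = Re (form y x)"
    using form_self(1)[of "x + scaleC \<i> y"] form_self(1)[of x] form_self(1)[of y]
    by (simp add: form_add_left form_add_right form_scaleC_left form_scaleC_right)
  ultimately show ?thesis by (simp add: complex_eq_iff)
qed

lemma seminorm_nonneg [simp]: "0 \<le> seminorm x"
  by (simp add: seminorm_def form_self)

lemma seminorm_square: "(seminorm x)\<^sup>2 = Re (form x x)"
  by (simp add: seminorm_def form_self)

text \<open>The square of the seminorm of \<open>x - t \<langle>x, y\<rangle>\<^sup>* y\<close>, with the scalar \<open>\<langle>x, y\<rangle>\<close> of the form, is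
  nonnegative for every real \<open>t\<close>. If the seminorm of \<open>y\<close> vanishes, this expression is affine in \<open>t\<close>, so
  its slope must be zero.\<close>

lemma Cauchy_Schwarz_form: "cmod (form x y) \<le> seminorm x * seminorm y"
proof -
  define A B P where "A = Re (form x x)" and "B = Re (form y y)" and "P = (cmod (form x y))\<^sup>2"
  have key: "0 \<le> A - 2 * t * P + t * t * P * B" for t
  proof -
    define c where "c = - of_real t * cnj (form x y)"
    define z where "z = x + scaleC c y"
    have "form z z = form x x + c * form x y + cnj (c * form x y) + (c * cnj c) * form y y"
      by (simp add: z_def form_add_left form_add_right form_scaleC_left form_scaleC_right
          form_commute[of y x] distrib_left mult.assoc)
    moreover have P_eq: "complex_of_real P = form x y * cnj (form x y)"
      by (simp only: P_def complex_norm_square)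
    have "c * form x y = of_real (- t * P)"
      unfolding c_def of_real_mult of_real_minus P_eq
      by (simp only: mult_minus_left mult.assoc mult.commute[of "cnj (form x y)"])
    moreover have "c * cnj c = of_real (t * t * P)"
      unfolding c_def of_real_mult P_eq complex_cnj_mult complex_cnj_minus
        complex_cnj_complex_of_real complex_cnj_cnj
      by (simp only: mult_minus_left mult_minus_right minus_minus ac_simps)
    ultimately have "Re (form z z) = A - 2 * t * P + t * t * P * B"
      by (simp add: A_def B_def)
    then show ?thesis using form_self(2)[of z] by simp
  qed
  have "P \<le> A * B"
  proof (cases "B = 0")
    case True
    have "P = 0"
    proof (rule ccontr)
      assume "P \<noteq> 0"
      \<comment> \<open>at this value of \<open>t\<close> the affine function takes the value \<open>- 1\<close>\<close>
      then have "2 * ((A + 1) / (2 * P)) * P = A + 1" by simp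
      then have "A + 1 \<le> A" using key[of "(A + 1) / (2 * P)"] True by simp
      then show False by simp
    qed
    then show ?thesis using True by simp
  next
    case False
    then have "0 < B" using form_self(2)[of y] by (simp add: B_def)
    then have "0 \<le> A - P / B" using key[of "1 / B"] by simp
    then show ?thesis using \<open>0 < B\<close> by (simp add: pos_divide_le_eq)
  qed
  then have "(cmod (form x y))\<^sup>2 \<le> (seminorm x * seminorm y)\<^sup>2"
    by (simp add: P_def A_def B_def seminorm_square power_mult_distrib)
  then show ?thesis by (rule power2_le_imp_le) simp
qed

lemma seminorm_add: "seminorm (x + y) \<le> seminorm x + seminorm y"
proof -
  have "(seminorm (x + y))\<^sup>2 = (seminorm x)\<^sup>2 + 2 * Re (form x y) + (seminorm y)\<^sup>2"
    by (simp add: seminorm_square form_add_left form_add_right form_commute[of y x])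
  also have "\<dots> \<le> (seminorm x + seminorm y)\<^sup>2"
    using complex_Re_le_cmod[of "form x y"] Cauchy_Schwarz_form[of x y] by (simp add: power2_sum)
  finally show ?thesis by (rule power2_le_imp_le) simp
qed

lemma seminorm_scaleC: "seminorm (scaleC c x) = cmod c * seminorm x"
proof -
  have "form (scaleC c x) (scaleC c x) = complex_of_real ((cmod c)\<^sup>2) * form x x"
    unfolding form_scaleC_left form_scaleC_right complex_norm_square by (simp only: ac_simps)
  then have "Re (form (scaleC c x) (scaleC c x)) = (cmod c)\<^sup>2 * Re (form x x)"
    by (simp only: Re_complex_of_real Im_complex_of_real times_complex.sel mult_zero_left diff_0_right)
  then show ?thesis by (simp add: seminorm_def real_sqrt_mult)
qed

lemma seminorm_zero [simp]: "seminorm 0 = 0"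
  using seminorm_scaleC[of 0 0] by simp

lemma seminorm_minus_commute: "seminorm (x - y) = seminorm (y - x)"
  using seminorm_scaleC[of "-1" "x - y"] by (simp add: scaleC_minus_left)

lemma seminorm_triangle: "seminorm (x - z) \<le> seminorm (x - y) + seminorm (y - z)"
  using seminorm_add[of "x - y" "y - z"] by simp

lemma form_diff_le:
  "cmod (form x y - form x' y') \<le> seminorm (x - x') * seminorm y + seminorm x' * seminorm (y - y')"
proof -
  have "form x y - form x' y' = form (x - x') y + form x' (y - y')"
    by (simp add: form_diff_left form_diff_right)
  then show ?thesis
    using Cauchy_Schwarz_form[of "x - x'" y] Cauchy_Schwarz_form[of x' "y - y'"]
      norm_triangle_ineq[of "form (x - x') y" "form x' (y - y')"] by simp
qed

abbreviation quot :: "'e set ipspace" where "quot \<equiv> quotient_space ip f"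
definition cls :: "'e \<Rightarrow> 'e set" where "cls x = null_rel ip f `` {x}"

lemma mem_cls: "y \<in> cls x \<longleftrightarrow> seminorm (x - y) = 0"
  using form_self[of "x - y"]
  by (auto simp: cls_def null_rel_def null_space_def seminorm_def form_def complex_eq_iff)

lemma cls_eqI: "seminorm (x - y) = 0 \<Longrightarrow> cls x = cls y"
proof -
  assume xy: "seminorm (x - y) = 0"
  have "seminorm (x - z) = seminorm (y - z)" for z
    using seminorm_triangle[of x z y] seminorm_triangle[of y z x] xy
    by (simp add: seminorm_minus_commute[of y x])
  then show ?thesis by (auto simp: mem_cls)
qed

lemma self_mem_cls: "x \<in> cls x"
  by (simp add: mem_cls)

lemma vecs_quot: "vecs quot = range cls"
  by (auto simp: quotient_space_def quotient_def cls_def)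

lemma vinner_quot: "vinner quot (cls x) (cls y) = form x y"
proof -
  have "form x' y' = form x y" if "x' \<in> cls x" "y' \<in> cls y" for x' y'
    using form_diff_le[of x y x' y'] that by (simp add: mem_cls)
  then have "(\<Union>x'\<in>cls x. \<Union>y'\<in>cls y. {form x' y'}) = (\<Union>x'\<in>cls x. \<Union>y'\<in>cls y. {form x y})"
    by (intro SUP_cong refl) simp
  also have "\<dots> = {form x y}" using self_mem_cls[of x] self_mem_cls[of y] by auto
  finally have "(\<Union>x'\<in>cls x. \<Union>y'\<in>cls y. {form x' y'}) = {form x y}" .
  then show ?thesis by (simp add: quotient_space_def form_def)
qed

lemma vadd_quot: "vadd quot (cls x) (cls y) = cls (x + y)"
proof -
  have "cls (x' + y') = cls (x + y)" if "x' \<in> cls x" "y' \<in> cls y" for x' y'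
  proof (rule cls_eqI)
    have "seminorm (x' + y' - (x + y)) \<le> seminorm (x - x') + seminorm (y - y')"
      using seminorm_add[of "x' - x" "y' - y"] by (simp add: seminorm_minus_commute algebra_simps)
    then show "seminorm (x' + y' - (x + y)) = 0"
      using that seminorm_nonneg[of "x' + y' - (x + y)"] by (simp add: mem_cls del: seminorm_nonneg)
  qed
  then have "(\<Union>x'\<in>cls x. \<Union>y'\<in>cls y. cls (x' + y')) = cls (x + y)"
    using self_mem_cls by blast
  then show ?thesis by (simp add: quotient_space_def flip: cls_def)
qed

lemma vscale_quot: "vscale quot c (cls x) = cls (scaleC c x)"
proof -
  have "cls (scaleC c x') = cls (scaleC c x)" if "x' \<in> cls x" for x'
    using that by (intro cls_eqI)
      (simp add: mem_cls seminorm_scaleC seminorm_minus_commute[of x'] flip: scaleC_diff_right)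
  then have "(\<Union>x'\<in>cls x. cls (scaleC c x')) = cls (scaleC c x)"
    using self_mem_cls by blast
  then show ?thesis by (simp add: quotient_space_def flip: cls_def)
qed

lemma vdist_quot: "vdist quot (cls x) (cls y) = seminorm (x - y)"
  by (simp add: vdist_def vnorm_def vscale_quot vadd_quot vinner_quot seminorm_def scaleC_minus_left)

definition seq_cls :: "(nat \<Rightarrow> 'e) \<Rightarrow> nat \<Rightarrow> 'e set" where "seq_cls X = (\<lambda>n. cls (X n))"

definition limit_pt :: "(nat \<Rightarrow> 'e) \<Rightarrow> (nat \<Rightarrow> 'e set) set" where
  "limit_pt X = cauchy_rel quot `` {seq_cls X}"

abbreviation "cauchy X \<equiv> vCauchy quot (seq_cls X)"

lemma cauchy_iff: "cauchy X \<longleftrightarrow> (\<forall>e>0. \<exists>N. \<forall>m\<ge>N. \<forall>n\<ge>N. seminorm (X m - X n) < e)"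
  by (auto simp: vCauchy_def seq_cls_def vecs_quot vdist_quot)

lemma vCauchy_quot_cases:
  assumes "vCauchy quot P"
  obtains X where "P = seq_cls X" "cauchy X"
proof -
  have "\<forall>n. \<exists>x. P n = cls x" using assms unfolding vCauchy_def vecs_quot by blast
  then obtain X where "\<And>n. P n = cls (X n)" by metis
  then have "P = seq_cls X" by (auto simp: seq_cls_def)
  then show ?thesis using assms that by blast
qed

lemma cauchy_rel_iff:
  "(seq_cls X, seq_cls Y) \<in> cauchy_rel quot \<longleftrightarrow>
     cauchy X \<and> cauchy Y \<and> (\<lambda>n. seminorm (X n - Y n)) \<longlonglongrightarrow> 0"
  by (simp add: cauchy_rel_def) (simp add: seq_cls_def vdist_quot)

lemma limit_pt_cases:
  assumes "P \<in> limit_pt X"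
  obtains Y where "P = seq_cls Y" "cauchy X" "cauchy Y" "(\<lambda>n. seminorm (X n - Y n)) \<longlonglongrightarrow> 0"
proof -
  have "vCauchy quot P" using assms by (auto simp: limit_pt_def cauchy_rel_def)
  then obtain Y where "P = seq_cls Y" by (rule vCauchy_quot_cases)
  then show ?thesis using assms that[of Y] by (simp add: limit_pt_def cauchy_rel_iff)
qed

lemma seq_cls_mem_limit_pt: "cauchy X \<Longrightarrow> seq_cls X \<in> limit_pt X"
  by (simp add: limit_pt_def cauchy_rel_iff)

lemma limit_pt_eqI:
  assumes "cauchy X" "cauchy Y" and XY: "(\<lambda>n. seminorm (X n - Y n)) \<longlonglongrightarrow> 0"
  shows "limit_pt X = limit_pt Y"
proof -
  have sub: "limit_pt Y \<subseteq> limit_pt X"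
    if XY: "(\<lambda>n. seminorm (X n - Y n)) \<longlonglongrightarrow> 0" and "cauchy X" for X Y
  proof
    fix P assume "P \<in> limit_pt Y"
    then obtain Z where Z: "P = seq_cls Z" "cauchy Z" "(\<lambda>n. seminorm (Y n - Z n)) \<longlonglongrightarrow> 0"
      by (rule limit_pt_cases)
    have "(\<lambda>n. seminorm (X n - Z n)) \<longlonglongrightarrow> 0"
    proof (rule Lim_null_comparison)
      show "\<forall>\<^sub>F n in sequentially.
          norm (seminorm (X n - Z n)) \<le> seminorm (X n - Y n) + seminorm (Y n - Z n)"
        by (simp add: seminorm_triangle)
      show "(\<lambda>n. seminorm (X n - Y n) + seminorm (Y n - Z n)) \<longlonglongrightarrow> 0"
        using tendsto_add[OF XY Z(3)] by simp
    qed
    then show "P \<in> limit_pt X"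
      using Z \<open>cauchy X\<close> by (simp add: limit_pt_def cauchy_rel_iff)
  qed
  have "(\<lambda>n. seminorm (Y n - X n)) \<longlonglongrightarrow> 0"
    using XY by (simp add: seminorm_minus_commute)
  then show ?thesis using sub[OF XY] sub[of Y X] assms by blast
qed

lemma vecs_localization: "P \<in> vecs (localization ip f) \<longleftrightarrow> (\<exists>X. cauchy X \<and> P = limit_pt X)"
proof -
  have "P \<in> vecs (localization ip f) \<longleftrightarrow> (\<exists>Q. vCauchy quot Q \<and> P = cauchy_rel quot `` {Q})"
    by (auto simp: localization_def completion_def quotient_def)
  then show ?thesis unfolding limit_pt_def using vCauchy_quot_cases by metis
qed

lemma cauchy_seminorm_Cauchy: "cauchy X \<Longrightarrow> Cauchy (\<lambda>n. seminorm (X n))"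
proof (rule CauchyI)
  fix e :: real assume X: "cauchy X" and "0 < e"
  then obtain N where N: "\<And>m n. m \<ge> N \<Longrightarrow> n \<ge> N \<Longrightarrow> seminorm (X m - X n) < e"
    unfolding cauchy_iff by blast
  have "\<bar>seminorm x - seminorm y\<bar> \<le> seminorm (x - y)" for x y
    using seminorm_add[of "x - y" y] seminorm_add[of "y - x" x] seminorm_minus_commute[of x y]
    by simp
  then show "\<exists>M. \<forall>m\<ge>M. \<forall>n\<ge>M. norm (seminorm (X m) - seminorm (X n)) < e"
    using N by (metis le_less_trans real_norm_def)
qed

lemma cauchy_bounded:
  assumes "cauchy X" obtains B where "0 < B" "\<And>n. seminorm (X n) \<le> B"
proof -
  have "Bseq (\<lambda>n. seminorm (X n))"
    using cauchy_seminorm_Cauchy[OF assms] by (rule Cauchy_Bseq)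
  then show ?thesis using that by (auto simp: Bseq_def)
qed

lemma convergent_form:
  assumes "cauchy X" "cauchy Y"
  shows "convergent (\<lambda>n. form (X n) (Y n))"
proof -
  obtain A where A: "0 < A" "\<And>n. seminorm (X n) \<le> A" using assms(1) by (rule cauchy_bounded) blast
  obtain B where B: "0 < B" "\<And>n. seminorm (Y n) \<le> B" using assms(2) by (rule cauchy_bounded) blast
  have "Cauchy (\<lambda>n. form (X n) (Y n))"
  proof (rule CauchyI)
    fix e :: real assume e: "0 < e"
    obtain M where M: "\<And>m n. m \<ge> M \<Longrightarrow> n \<ge> M \<Longrightarrow> seminorm (X m - X n) < e / (2 * B)"
      using assms(1) e B(1) unfolding cauchy_iff by (meson divide_pos_pos zero_less_mult_iff zero_less_numeral)
    obtain N where N: "\<And>m n. m \<ge> N \<Longrightarrow> n \<ge> N \<Longrightarrow> seminorm (Y m - Y n) < e / (2 * A)"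
      using assms(2) e A(1) unfolding cauchy_iff by (meson divide_pos_pos zero_less_mult_iff zero_less_numeral)
    have "norm (form (X m) (Y m) - form (X n) (Y n)) < e" if "m \<ge> max M N" "n \<ge> max M N" for m n
    proof -
      have "seminorm (X m - X n) * seminorm (Y m) \<le> seminorm (X m - X n) * B"
        by (rule mult_left_mono) (simp_all add: B)
      also have "\<dots> < e / (2 * B) * B" using M[of m n] that B(1) by (intro mult_strict_right_mono) auto
      finally have 1: "seminorm (X m - X n) * seminorm (Y m) < e / 2" using B(1) by simp
      have "seminorm (X n) * seminorm (Y m - Y n) \<le> A * seminorm (Y m - Y n)"
        by (rule mult_right_mono) (simp_all add: A)
      also have "\<dots> < A * (e / (2 * A))" using N[of m n] that A(1) by (intro mult_strict_left_mono) auto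
      finally have 2: "seminorm (X n) * seminorm (Y m - Y n) < e / 2" using A(1) by simp
      show ?thesis using form_diff_le[of "X m" "Y m" "X n" "Y n"] 1 2 by simp
    qed
    then show "\<exists>K. \<forall>m\<ge>K. \<forall>n\<ge>K. norm (form (X m) (Y m) - form (X n) (Y n)) < e" by blast
  qed
  then show ?thesis by (simp add: Cauchy_convergent_iff)
qed

text \<open>The union in the definition of the completed inner product is a singleton because the limit does not
  depend on the representing sequences.\<close>

lemma vinner_localization:
  assumes X: "cauchy X" and Y: "cauchy Y"
  shows "(\<lambda>n. form (X n) (Y n)) \<longlonglongrightarrow> vinner (localization ip f) (limit_pt X) (limit_pt Y)"
proof -
  define l where "l = lim (\<lambda>n. form (X n) (Y n))"
  have l: "(\<lambda>n. form (X n) (Y n)) \<longlonglongrightarrow> l"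
    using convergent_form[OF X Y] by (simp add: l_def convergent_LIMSEQ_iff)
  obtain B where B: "0 < B" "\<And>n. seminorm (Y n) \<le> B" using Y by (rule cauchy_bounded) blast
  have "lim (\<lambda>n. vinner quot (P n) (Q n)) = l"
    if P: "P \<in> limit_pt X" and Q: "Q \<in> limit_pt Y" for P Q
  proof -
    obtain X' where X': "P = seq_cls X'" "cauchy X'" "(\<lambda>n. seminorm (X n - X' n)) \<longlonglongrightarrow> 0"
      using P by (rule limit_pt_cases)
    obtain Y' where Y': "Q = seq_cls Y'" "cauchy Y'" "(\<lambda>n. seminorm (Y n - Y' n)) \<longlonglongrightarrow> 0"
      using Q by (rule limit_pt_cases)
    obtain A where A: "0 < A" "\<And>n. seminorm (X' n) \<le> A" using X'(2) by (rule cauchy_bounded) blast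
    have "(\<lambda>n. form (X n) (Y n) - form (X' n) (Y' n)) \<longlonglongrightarrow> 0"
    proof (rule Lim_null_comparison)
      show "\<forall>\<^sub>F n in sequentially. norm (form (X n) (Y n) - form (X' n) (Y' n))
          \<le> seminorm (X n - X' n) * B + A * seminorm (Y n - Y' n)"
        by (intro always_eventually allI order_trans[OF form_diff_le] add_mono mult_left_mono
            mult_right_mono) (simp_all add: A B)
      show "(\<lambda>n. seminorm (X n - X' n) * B + A * seminorm (Y n - Y' n)) \<longlonglongrightarrow> 0"
        using tendsto_add[OF tendsto_mult_right[OF X'(3), of B] tendsto_mult_left[OF Y'(3), of A]]
        by simp
    qed
    from tendsto_diff[OF l this] have "(\<lambda>n. form (X' n) (Y' n)) \<longlonglongrightarrow> l" by simp
    then show ?thesis by (simp add: X' Y' seq_cls_def vinner_quot limI)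
  qed
  then have "(\<Union>P\<in>limit_pt X. \<Union>Q\<in>limit_pt Y. {lim (\<lambda>n. vinner quot (P n) (Q n))}) = {l}"
    using seq_cls_mem_limit_pt[OF X] seq_cls_mem_limit_pt[OF Y] by blast
  then have "vinner (localization ip f) (limit_pt X) (limit_pt Y) = l"
    by (simp add: localization_def completion_def)
  then show ?thesis using l by simp
qed

lemma vnorm_localization:
  assumes X: "cauchy X"
  shows "(\<lambda>n. seminorm (X n)) \<longlonglongrightarrow> vnorm (localization ip f) (limit_pt X)"
  unfolding seminorm_def vnorm_def
  by (intro tendsto_real_sqrt tendsto_Re vinner_localization X)

lemma Cauchy_Schwarz_localization:
  assumes P: "P \<in> vecs (localization ip f)" and Q: "Q \<in> vecs (localization ip f)"
  shows "cmod (vinner (localization ip f) P Q)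
    \<le> vnorm (localization ip f) P * vnorm (localization ip f) Q"
proof -
  obtain X where X: "cauchy X" "P = limit_pt X" using P by (auto simp: vecs_localization)
  obtain Y where Y: "cauchy Y" "Q = limit_pt Y" using Q by (auto simp: vecs_localization)
  have "(\<lambda>n. cmod (form (X n) (Y n))) \<longlonglongrightarrow> cmod (vinner (localization ip f) P Q)"
    unfolding X Y by (intro tendsto_norm vinner_localization X Y)
  moreover have "(\<lambda>n. seminorm (X n) * seminorm (Y n))
      \<longlonglongrightarrow> vnorm (localization ip f) P * vnorm (localization ip f) Q"
    unfolding X Y by (intro tendsto_mult vnorm_localization X Y)
  ultimately show ?thesis
    by (rule LIMSEQ_le) (auto intro: Cauchy_Schwarz_form)
qed

lemma vnorm_nonneg: "P \<in> vecs (localization ip f) \<Longrightarrow> 0 \<le> vnorm (localization ip f) P"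
  unfolding vecs_localization
  by (elim exE conjE, simp only:) (rule LIMSEQ_le_const[OF vnorm_localization], auto)

text \<open>A supremum of reals is meaningful only for bounded sets. Here and for the supremum over all states
  below, \<open>1\<close> is a bound by the Cauchy-Schwarz inequality in the completion.\<close>

lemma dixmier_set_le_one:
  assumes "M \<subseteq> vecs (localization ip f)" "N \<subseteq> vecs (localization ip f)"
    and "c \<in> {cmod (vinner (localization ip f) x y) | x y. x \<in> M \<and> y \<in> N
      \<and> vnorm (localization ip f) x \<le> 1 \<and> vnorm (localization ip f) y \<le> 1}"
  shows "c \<le> 1"
proof -
  obtain x y where xy: "c = cmod (vinner (localization ip f) x y)" "x \<in> M" "y \<in> N"
    "vnorm (localization ip f) x \<le> 1" "vnorm (localization ip f) y \<le> 1"
    using assms(3) by auto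
  have "0 \<le> vnorm (localization ip f) y"
    using xy(3) assms(2) by (intro vnorm_nonneg) blast
  then have "vnorm (localization ip f) x * vnorm (localization ip f) y \<le> 1"
    using xy by (intro mult_le_one)
  moreover have "c \<le> vnorm (localization ip f) x * vnorm (localization ip f) y"
    unfolding xy(1) using xy(2,3) assms(1,2) by (intro Cauchy_Schwarz_localization) auto
  ultimately show ?thesis by simp
qed

abbreviation embed :: "'e \<Rightarrow> (nat \<Rightarrow> 'e set) set" where
  "embed x \<equiv> to_completion quot (cls x)"

lemma embed_eq: "embed x = limit_pt (\<lambda>_. x)"
  by (simp add: to_completion_def limit_pt_def seq_cls_def)

lemma cauchy_const: "cauchy (\<lambda>_. x)"
  by (simp add: cauchy_iff)

lemma vinner_embed: "vinner (localization ip f) (embed x) (embed y) = form x y"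
  using vinner_localization[OF cauchy_const cauchy_const, of x y]
  by (simp add: embed_eq LIMSEQ_const_iff)

lemma vnorm_embed: "vnorm (localization ip f) (embed x) = seminorm x"
  by (simp add: vnorm_def vinner_embed seminorm_def)

lemma vscale_embed: "vscale (localization ip f) c (embed x) = embed (scaleC c x)"
proof -
  have "cauchy_rel quot `` {\<lambda>n. vscale quot c (P n)} = embed (scaleC c x)" if P: "P \<in> embed x" for P
  proof -
    obtain X where X: "P = seq_cls X" "cauchy X" "(\<lambda>n. seminorm (x - X n)) \<longlonglongrightarrow> 0"
      using P unfolding embed_eq by (rule limit_pt_cases)
    have "cauchy (\<lambda>n. scaleC c (X n))"
      unfolding cauchy_iff
    proof (intro allI impI)
      fix e :: real assume "0 < e"
      then have "0 < e / (cmod c + 1)" by (simp add: add_nonneg_pos)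
      then obtain N where N: "\<forall>m\<ge>N. \<forall>n\<ge>N. seminorm (X m - X n) < e / (cmod c + 1)"
        using X(2) unfolding cauchy_iff by blast
      have "cmod c * s < e" if "0 \<le> s" "s < e / (cmod c + 1)" for s
      proof -
        have "(cmod c + 1) * s < e" using that by (simp add: pos_less_divide_eq add_nonneg_pos mult.commute)
        then show ?thesis using that(1) by (simp add: distrib_right)
      qed
      then show "\<exists>N. \<forall>m\<ge>N. \<forall>n\<ge>N. seminorm (scaleC c (X m) - scaleC c (X n)) < e"
        using N seminorm_nonneg unfolding scaleC_diff_right[symmetric] seminorm_scaleC by blast
    qed
    moreover have "(\<lambda>n. seminorm (scaleC c (X n) - scaleC c x)) \<longlonglongrightarrow> 0"
      using tendsto_mult_left[OF X(3), of "cmod c"]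
      by (simp add: seminorm_scaleC seminorm_minus_commute[of x] flip: scaleC_diff_right)
    ultimately have "limit_pt (\<lambda>n. scaleC c (X n)) = embed (scaleC c x)"
      unfolding embed_eq by (intro limit_pt_eqI cauchy_const)
    then show ?thesis by (simp add: X limit_pt_def seq_cls_def vscale_quot)
  qed
  moreover have "embed x \<noteq> {}" using seq_cls_mem_limit_pt[OF cauchy_const] by (auto simp: embed_eq)
  ultimately have "(\<Union>P\<in>embed x. cauchy_rel quot `` {\<lambda>n. vscale quot c (P n)}) = embed (scaleC c x)"
    by blast
  then show ?thesis by (simp add: localization_def completion_def)
qed

lemma vadd_embed: "vadd (localization ip f) (embed x) (embed y) = embed (x + y)"
proof -
  have "cauchy_rel quot `` {\<lambda>n. vadd quot (P n) (Q n)} = embed (x + y)"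
    if P: "P \<in> embed x" and Q: "Q \<in> embed y" for P Q
  proof -
    obtain X where X: "P = seq_cls X" "cauchy X" "(\<lambda>n. seminorm (x - X n)) \<longlonglongrightarrow> 0"
      using P unfolding embed_eq by (rule limit_pt_cases)
    obtain Y where Y: "Q = seq_cls Y" "cauchy Y" "(\<lambda>n. seminorm (y - Y n)) \<longlonglongrightarrow> 0"
      using Q unfolding embed_eq by (rule limit_pt_cases)
    have le: "seminorm ((a + b) - (a' + b')) \<le> seminorm (a - a') + seminorm (b - b')" for a b a' b'
      using seminorm_add[of "a - a'" "b - b'"] by (simp add: algebra_simps)
    have "cauchy (\<lambda>n. X n + Y n)"
      unfolding cauchy_iff
    proof (intro allI impI)
      fix e :: real assume e: "0 < e"
      obtain M where M: "\<forall>m\<ge>M. \<forall>n\<ge>M. seminorm (X m - X n) < e / 2"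
        using X(2) e unfolding cauchy_iff by (meson half_gt_zero)
      obtain N where N: "\<forall>m\<ge>N. \<forall>n\<ge>N. seminorm (Y m - Y n) < e / 2"
        using Y(2) e unfolding cauchy_iff by (meson half_gt_zero)
      have "seminorm ((X m + Y m) - (X n + Y n)) < e" if "m \<ge> max M N" "n \<ge> max M N" for m n
      proof -
        have "seminorm (X m - X n) < e / 2" "seminorm (Y m - Y n) < e / 2" using M N that by auto
        then show ?thesis using le[of "X m" "Y m" "X n" "Y n"] by simp
      qed
      then show "\<exists>N. \<forall>m\<ge>N. \<forall>n\<ge>N. seminorm ((X m + Y m) - (X n + Y n)) < e" by blast
    qed
    moreover have "(\<lambda>n. seminorm ((x + y) - (X n + Y n))) \<longlonglongrightarrow> 0"
    proof (rule Lim_null_comparison)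
      show "\<forall>\<^sub>F n in sequentially.
          norm (seminorm ((x + y) - (X n + Y n))) \<le> seminorm (x - X n) + seminorm (y - Y n)"
        using le[of x y] by simp
      show "(\<lambda>n. seminorm (x - X n) + seminorm (y - Y n)) \<longlonglongrightarrow> 0"
        using tendsto_add[OF X(3) Y(3)] by simp
    qed
    ultimately have "embed (x + y) = limit_pt (\<lambda>n. X n + Y n)"
      unfolding embed_eq by (intro limit_pt_eqI cauchy_const)
    then show ?thesis by (simp add: X Y limit_pt_def seq_cls_def vadd_quot)
  qed
  moreover have "embed x \<noteq> {}" "embed y \<noteq> {}"
    using seq_cls_mem_limit_pt[OF cauchy_const] by (auto simp: embed_eq)
  ultimately have "(\<Union>P\<in>embed x. \<Union>Q\<in>embed y. cauchy_rel quot `` {\<lambda>n. vadd quot (P n) (Q n)})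
      = embed (x + y)"
    by blast
  then show ?thesis by (simp add: localization_def completion_def)
qed

lemma embed_mem_localized_submodule:
  assumes "x \<in> M"
  shows "embed x \<in> localized_submodule ip f M"
proof -
  have "vdist (localization ip f) (embed x) (embed x) = 0"
    by (simp add: vdist_def vscale_embed vadd_embed vnorm_embed scaleC_minus_left)
  moreover have "embed x \<in> vecs (localization ip f)"
    using cauchy_const by (auto simp: vecs_localization embed_eq)
  ultimately show ?thesis
    using assms unfolding localized_submodule_def vclosure_def
    by (intro CollectI conjI allI impI bexI[where x = "embed x"] image_eqI[where x = x])
      (simp_all add: cls_def)
qed

lemma localized_submodule_subset: "localized_submodule ip f M \<subseteq> vecs (localization ip f)"
  by (auto simp: localized_submodule_def vclosure_def)

lemma dixmier_cos_localized_le_one: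
  assumes "0 \<in> M" "0 \<in> N"
  shows "dixmier_cos (localization ip f) (localized_submodule ip f M) (localized_submodule ip f N) \<le> 1"
  unfolding dixmier_cos_def
proof (rule cSup_least)
  show "{cmod (vinner (localization ip f) x y) | x y. x \<in> localized_submodule ip f M
    \<and> y \<in> localized_submodule ip f N \<and> vnorm (localization ip f) x \<le> 1
    \<and> vnorm (localization ip f) y \<le> 1} \<noteq> {}"
    using embed_mem_localized_submodule[OF assms(1)] embed_mem_localized_submodule[OF assms(2)]
      vnorm_embed[of 0] zero_le_one[where 'a = real] unfolding seminorm_zero ex_in_conv[symmetric]
    by (intro exI[of _ "cmod (vinner (localization ip f) (embed 0) (embed 0))"]) force
qed (rule dixmier_set_le_one[OF localized_submodule_subset localized_submodule_subset])

text \<open>Vectors of positive seminorm are normalized before they are passed to the completion; if one of the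
  seminorms is zero, both sides vanish.\<close>

lemma form_le_dixmier_cos:
  assumes M: "closed_submodule act M" and N: "closed_submodule act N" and x: "x \<in> M" and y: "y \<in> N"
  shows "cmod (form x y)
    \<le> dixmier_cos (localization ip f) (localized_submodule ip f M) (localized_submodule ip f N)
      * seminorm x * seminorm y"
proof (cases "seminorm x = 0 \<or> seminorm y = 0")
  case True
  then show ?thesis using Cauchy_Schwarz_form[of x y] by auto
next
  case False
  then have pos: "0 < seminorm x" "0 < seminorm y" using seminorm_nonneg[of x] seminorm_nonneg[of y] by linarith+
  define u where "u = scaleC (complex_of_real (1 / seminorm x)) x"
  define v where "v = scaleC (complex_of_real (1 / seminorm y)) y"
  have uv: "u \<in> M" "v \<in> N" using M N x y by (auto simp: closed_submodule_def u_def v_def)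
  have "seminorm u = 1" "seminorm v = 1"
    using pos by (simp_all add: u_def v_def seminorm_scaleC norm_divide)
  then have "vnorm (localization ip f) (embed u) \<le> 1" "vnorm (localization ip f) (embed v) \<le> 1"
    by (simp_all add: vnorm_embed)
  with uv have "cmod (vinner (localization ip f) (embed u) (embed v)) \<le>
      dixmier_cos (localization ip f) (localized_submodule ip f M) (localized_submodule ip f N)"
    unfolding dixmier_cos_def
    by (intro cSup_upper bdd_aboveI[of _ 1]
        dixmier_set_le_one[OF localized_submodule_subset localized_submodule_subset])
      (auto intro: embed_mem_localized_submodule)
  then have "cmod (form u v) \<le>
      dixmier_cos (localization ip f) (localized_submodule ip f M) (localized_submodule ip f N)"
    by (simp only: vinner_embed)
  moreover have "cmod (form u v) = cmod (form x y) / (seminorm x * seminorm y)"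
    using pos by (simp add: u_def v_def form_scaleC_left form_scaleC_right norm_mult norm_divide)
  ultimately show ?thesis using pos by (simp add: divide_le_eq mult.assoc)
qed

end

section \<open>Separated pairs\<close>

text \<open>If \<open>x\<^sub>n + y\<^sub>n\<close> converges, the bound makes \<open>x\<^sub>n\<close> a Cauchy sequence, so both summands converge.\<close>

lemma closed_sum_if_norm_le:
  fixes M N :: "'v::banach set"
  assumes M: "subspace M" "closed M" and N: "subspace N" "closed N"
    and le: "\<And>x y. x \<in> M \<Longrightarrow> y \<in> N \<Longrightarrow> norm x \<le> C * norm (x + y)"
  shows "closed (M + N)"
  unfolding closed_sequential_limits
proof (intro allI impI, elim conjE)
  fix z l assume "\<forall>n. z n \<in> M + N" and z: "z \<longlonglongrightarrow> l"
  then have "\<forall>n. \<exists>x y. z n = x + y \<and> x \<in> M \<and> y \<in> N" by (simp add: set_plus_def) blast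
  then obtain x y where zxy: "\<And>n. z n = x n + y n" and x: "\<And>n. x n \<in> M" and y: "\<And>n. y n \<in> N"
    by metis
  have diff: "norm (x m - x n) \<le> (\<bar>C\<bar> + 1) * norm (z m - z n)" for m n
  proof -
    have "norm (x m - x n) \<le> C * norm ((x m - x n) + (y m - y n))"
      using M N x y by (intro le subspace_diff)
    also have "(x m - x n) + (y m - y n) = z m - z n" by (simp add: zxy)
    also have "C * norm (z m - z n) \<le> (\<bar>C\<bar> + 1) * norm (z m - z n)" by (intro mult_right_mono) auto
    finally show ?thesis .
  qed
  have "Cauchy x"
  proof (rule CauchyI)
    fix e :: real assume "0 < e"
    then have "0 < e / (\<bar>C\<bar> + 1)" by (simp add: add_nonneg_pos)
    with CauchyD[OF LIMSEQ_imp_Cauchy[OF z]]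
    obtain K where K: "\<And>m n. m \<ge> K \<Longrightarrow> n \<ge> K \<Longrightarrow> norm (z m - z n) < e / (\<bar>C\<bar> + 1)" by blast
    have "norm (x m - x n) < e" if "m \<ge> K" "n \<ge> K" for m n
    proof -
      have "(\<bar>C\<bar> + 1) * norm (z m - z n) < e"
        using K[OF that] by (simp add: pos_less_divide_eq add_nonneg_pos mult.commute)
      with diff[of m n] show ?thesis by (rule le_less_trans)
    qed
    then show "\<exists>K. \<forall>m\<ge>K. \<forall>n\<ge>K. norm (x m - x n) < e" by blast
  qed
  then obtain u where u: "x \<longlonglongrightarrow> u" by (auto simp: Cauchy_convergent_iff convergent_def)
  have "u \<in> M" using M(2) x u by (auto simp: closed_sequential_limits)
  moreover have "(\<lambda>n. z n - x n) \<longlonglongrightarrow> l - u" by (intro tendsto_diff z u)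
  then have "l - u \<in> N" using N(2) y by (auto simp: closed_sequential_limits zxy)
  ultimately have "u + (l - u) \<in> M + N" by (rule set_plus_intro)
  then show "l \<in> M + N" by simp
qed

lemma closed_submodule_imp_subspace: "closed_submodule act M \<Longrightarrow> subspace M"
  by (simp add: closed_submodule_def subspace_def scaleR_eq_scaleC)

context hilbert_module
begin

text \<open>Applied to a state that is norming for \<open>\<langle>x, x\<rangle>\<close>, the angle bound gives the estimate via
  \<open>s\<^sup>2 - 2 c s r + r\<^sup>2 = (1 - c) s\<^sup>2 + c (s - r)\<^sup>2 + (1 - c) r\<^sup>2\<close> for the seminorms \<open>s\<close> of \<open>x\<close> and \<open>r\<close> of
  \<open>y\<close>.\<close>

lemma norm_square_le_if_local_dixmier_cos:
  assumes M: "closed_submodule act M" and N: "closed_submodule act N" and x: "x \<in> M" and y: "y \<in> N"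
    and c: "local_dixmier_cos ip M N \<le> c" "0 \<le> c" "c \<le> 1"
  shows "(1 - c) * (norm x)\<^sup>2 \<le> (norm (x + y))\<^sup>2"
proof (cases "x = 0")
  case False
  let ?cos = "\<lambda>f. dixmier_cos (localization ip f) (localized_submodule ip f M) (localized_submodule ip f N)"
  have "ip x x \<noteq> 0" using False ip_definite by blast
  then obtain f where f: "state f" and f_ip: "f (ip x x) = complex_of_real (norm (ip x x))"
    using norming_state[OF ip_positive] by blast
  interpret localized_module act ip f
    by unfold_locales (use f in \<open>simp add: state_def\<close>)
  have "?cos g \<le> 1" if "state g" for g
  proof -
    interpret g: localized_module act ip g
      by unfold_locales (use that in \<open>simp add: state_def\<close>)
    show ?thesis
      using M N by (intro g.dixmier_cos_localized_le_one) (simp_all add: closed_submodule_def)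
  qed
  then have "bdd_above (?cos ` {f. state f})" by (auto simp: bdd_above_def)
  then have "?cos f \<le> local_dixmier_cos ip M N"
    unfolding local_dixmier_cos_def by (rule cSUP_upper2[OF _ _ order_refl]) (simp add: f)
  then have "?cos f \<le> c" using c(1) by simp
  then have "?cos f * (seminorm x * seminorm y) \<le> c * (seminorm x * seminorm y)"
    by (rule mult_right_mono) simp
  then have angle: "cmod (form x y) \<le> c * (seminorm x * seminorm y)"
    using form_le_dixmier_cos[OF M N x y] by (simp add: mult.assoc)
  have "0 \<le> c * (seminorm x - seminorm y)\<^sup>2 + (1 - c) * (seminorm y)\<^sup>2"
    using c by simp
  then have "(1 - c) * (seminorm x)\<^sup>2
      \<le> (seminorm x)\<^sup>2 - 2 * (c * (seminorm x * seminorm y)) + (seminorm y)\<^sup>2"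
    by (simp add: power2_eq_square algebra_simps)
  also have "\<dots> \<le> (seminorm x)\<^sup>2 + 2 * Re (form x y) + (seminorm y)\<^sup>2"
    using angle abs_Re_le_cmod[of "form x y"] by simp
  also have "\<dots> = Re (form (x + y) (x + y))"
    by (simp add: seminorm_square form_add_left form_add_right form_commute[of y x])
  also have "\<dots> \<le> cmod (f (ip (x + y) (x + y)))"
    unfolding form_def by (rule complex_Re_le_cmod)
  also have "\<dots> \<le> (norm (x + y))\<^sup>2"
    using onorm[of f "ip (x + y) (x + y)"] f by (simp add: state_def norm_ip_self)
  finally show ?thesis
    using f_ip by (simp add: seminorm_square form_def norm_ip_self)
qed simp

lemma separated_pair_if_local_dixmier_cos:
  assumes M: "closed_submodule act M" and N: "closed_submodule act N"
    and cos: "local_dixmier_cos ip M N < 1"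
    and dense: "(orth ip M \<inter> orth ip N) + closure (M + N) = UNIV"
  shows "separated_pair act ip M N"
proof -
  \<comment> \<open>over the zero algebra there are no states and the supremum is an unspecified real, possibly
    negative, hence the maximum with \<open>0\<close>\<close>
  define c where "c = max 0 (local_dixmier_cos ip M N)"
  have c: "local_dixmier_cos ip M N \<le> c" "0 \<le> c" "c < 1" using cos by (auto simp: c_def)
  have le: "norm x \<le> 1 / sqrt (1 - c) * norm (x + y)" if "x \<in> M" "y \<in> N" for x y
  proof -
    have "(sqrt (1 - c) * norm x)\<^sup>2 \<le> (norm (x + y))\<^sup>2"
      using norm_square_le_if_local_dixmier_cos[OF M N that c(1,2)] c(3)
      by (simp add: power_mult_distrib)
    then have "sqrt (1 - c) * norm x \<le> norm (x + y)" by (rule power2_le_imp_le) simp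
    then show ?thesis using c(3) by (simp add: pos_le_divide_eq mult.commute)
  qed
  have M0: "0 \<in> M" and N0: "0 \<in> N" using M N by (simp_all add: closed_submodule_def)
  have inter: "M \<inter> N = {0}"
  proof (intro equalityI subsetI)
    fix x assume x: "x \<in> M \<inter> N"
    then have "- x \<in> N" using subspace_neg[OF closed_submodule_imp_subspace[OF N]] by blast
    then show "x \<in> {0}" using le[of x "- x"] x by simp
  qed (use M0 N0 in simp)
  have "closed (M + N)"
    using M N by (intro closed_sum_if_norm_le[where C = "1 / sqrt (1 - c)"] closed_submodule_imp_subspace le)
      (auto simp: closed_submodule_def)
  then have "(orth ip M \<inter> orth ip N) + (M + N) = UNIV" using dense by (simp add: closure_closed)
  moreover have "orth ip M \<inter> orth ip N \<subseteq> orth ip (M + N)"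
    by (auto simp: orth_def set_plus_def ip_add_right)
  ultimately have "(M + N) + orth ip (M + N) = UNIV"
    using set_plus_mono2[of "orth ip M \<inter> orth ip N" "orth ip (M + N)" "M + N" "M + N"]
    by (intro top.extremum_uniqueI) (simp add: add.commute)
  then have "orth_complemented ip (M + N)"
    by (auto simp: orth_complemented_def orth_direct_sum_def orth_def intro: ip_eq_zero_commute)
  then show ?thesis using M N inter by (simp add: separated_pair_def)
qed

lemma orth_orth_orth: "orth ip (orth ip (orth ip M)) = orth ip M"
proof
  have "M \<subseteq> orth ip (orth ip M)" by (auto simp: orth_def intro: ip_eq_zero_commute)
  then show "orth ip (orth ip (orth ip M)) \<subseteq> orth ip M" by (auto simp: orth_def)
  show "orth ip M \<subseteq> orth ip (orth ip (orth ip M))" by (auto simp: orth_def intro: ip_eq_zero_commute)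
qed

end

theorem theorem3p14:
  fixes act :: "'e::complex_banach \<Rightarrow> 'a::cstar_algebra \<Rightarrow> 'e"
    and ip :: "'e \<Rightarrow> 'e \<Rightarrow> 'a"
    and H K :: "'e set"
  assumes "hilbert_module act ip"
    and "closed_submodule act H"
    and "closed_submodule act K"
    and "concordant act ip (orth ip H) (orth ip K)"
    and "local_dixmier_cos ip (orth ip (orth ip H)) (orth ip (orth ip K)) < 1"
  shows "separated_pair act ip (orth ip (orth ip H)) (orth ip (orth ip K))"
proof -
  interpret hilbert_module act ip by fact
  show ?thesis
    using assms(4,5)
    by (intro separated_pair_if_local_dixmier_cos closed_submodule_orth)
      (simp_all add: concordant_def orth_direct_sum_def orth_orth_orth)
qed

end
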